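(* For every integer $n\ge1$ there are constants $c(n)\in(0,1)$ and $C(n)>0$, depending only on $n$, such that the following holds. Let $r_0>0$ and let $u:B_{r_0}(0)\subseteq\mathbb{R}^2\to\mathbb{R}$ be a non-constant harmonic function with boundary value $u|_{S^1_{r_0}}\in L^1(S^1_{r_0})$ and $u(0)=0$. Assume that $u$ has only $n$ nodal curves in $B_{r_0}(0)$ and that they intersect at $0$. Then $$\big|\kappa(u)(z)\big|\le\frac{C(n)}{r_0}\qquad\text{for all } z\in (Z(u)\setminus\{0\})\cap B_{c(n)r_0}(0).$$
   Context: $B_r(p)$ is the open disk of radius $r$ centered at $p$ in $\mathbb{R}^2\cong\mathbb{C}$, and $S^1_r=\partial B_r(0)$. The nodal set of $u$ is $Z(u)=\{u=0\}$; it is a union of maximal real-analytic curves, called nodal curves. The assumption "only $n$ nodal curves intersecting at $0$" means that $Z(u)\cap B_{r_0}(0)$ consists of exactly $n$ nodal curves, all passing through $0$ (so $u$ vanishes at $0$ to order $n$). "Boundary value $u|_{S^1_{r_0}}=g\in L^1$" means that $u$ is the Poisson integral of $g$ in $B_{r_0}(0)$. For $z\in Z(u)\setminus\{0\}$, $\kappa(u)(z)$ is the curvature at $z$ of the nodal curve through $z$. *)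

theory Defs
  imports "HOL-Analysis.Analysis"
begin

text \<open>The plane is identified with the type of complex numbers. All functions are total; only their
  values on the disk \<open>ball 0 r\<close> (respectively on the open interval \<open>I\<close>) matter below.\<close>

definition harmonic_on :: "(complex \<Rightarrow> real) \<Rightarrow> complex set \<Rightarrow> bool"
    (infixl "harmonic'_on" 50) where
  "u harmonic_on S \<longleftrightarrow> open S \<and>
     (\<exists>ux uy uxx uxy uyx uyy :: complex \<Rightarrow> real.
        (\<forall>z\<in>S. (u has_derivative (\<lambda>h. ux z * Re h + uy z * Im h)) (at z) \<and>
               (ux has_derivative (\<lambda>h. uxx z * Re h + uxy z * Im h)) (at z) \<and>
               (uy has_derivative (\<lambda>h. uyx z * Re h + uyy z * Im h)) (at z) \<and>
               uxx z + uyy z = 0) \<and>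
        continuous_on S uxx \<and> continuous_on S uxy \<and>
        continuous_on S uyx \<and> continuous_on S uyy)"

text \<open>Integrability and the Poisson integral over the circle of radius \<open>r\<close> are expressed in the
  angular variable.\<close>

definition has_L1_boundary_value :: "(complex \<Rightarrow> real) \<Rightarrow> real \<Rightarrow> bool" where
  "has_L1_boundary_value u r \<longleftrightarrow>
     (\<exists>g :: complex \<Rightarrow> real.
        (\<lambda>\<theta>. g (of_real r * cis \<theta>)) absolutely_integrable_on {0..2 * pi} \<and>
        (\<forall>z\<in>ball 0 r.
           u z = 1 / (2 * pi) *
             integral {0..2 * pi}
               (\<lambda>\<theta>. (r\<^sup>2 - (cmod z)\<^sup>2) / (cmod (of_real r * cis \<theta> - z))\<^sup>2
                      * g (of_real r * cis \<theta>))))"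

definition nodal_set :: "(complex \<Rightarrow> real) \<Rightarrow> real \<Rightarrow> complex set" where
  "nodal_set u r = {z \<in> ball 0 r. u z = 0}"

definition real_analytic_on :: "(real \<Rightarrow> 'a::real_normed_vector) \<Rightarrow> real set \<Rightarrow> bool"
    (infixl "real'_analytic'_on" 50) where
  "f real_analytic_on I \<longleftrightarrow>
     (\<forall>t0\<in>I. \<exists>a. \<exists>e>0. \<forall>t. \<bar>t - t0\<bar> < e \<longrightarrow> (\<lambda>n. (t - t0) ^ n *\<^sub>R a n) sums f t)"

definition regular_analytic_param :: "(real \<Rightarrow> complex) \<Rightarrow> real set \<Rightarrow> bool" where
  "regular_analytic_param \<gamma> I \<longleftrightarrow>
     open I \<and> is_interval I \<and> I \<noteq> {} \<and> \<gamma> real_analytic_on I \<and>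
     (\<forall>t\<in>I. vector_derivative \<gamma> (at t) \<noteq> 0)"

text \<open>Real-analytic curves are identified with their traces, so that reparametrisations do not count
  as different curves; maximality is with respect to inclusion of traces.\<close>

definition analytic_curves_in :: "complex set \<Rightarrow> complex set set" where
  "analytic_curves_in Z = {\<gamma> ` I | \<gamma> I. regular_analytic_param \<gamma> I \<and> \<gamma> ` I \<subseteq> Z}"

definition nodal_curves :: "(complex \<Rightarrow> real) \<Rightarrow> real \<Rightarrow> complex set set" where
  "nodal_curves u r =
     {C \<in> analytic_curves_in (nodal_set u r).
        \<forall>C'\<in>analytic_curves_in (nodal_set u r). C \<subseteq> C' \<longrightarrow> C' = C}"

definition only_nodal_curves_through_0 :: "(complex \<Rightarrow> real) \<Rightarrow> real \<Rightarrow> nat \<Rightarrow> bool" where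
  "only_nodal_curves_through_0 u r n \<longleftrightarrow>
     finite (nodal_curves u r) \<and> card (nodal_curves u r) = n \<and>
     nodal_set u r = \<Union> (nodal_curves u r) \<and>
     (\<forall>C\<in>nodal_curves u r. 0 \<in> C)"

text \<open>Signed curvature \<open>det(\<gamma>', \<gamma>'') / |\<gamma>'|\<^sup>3\<close> of a regular plane curve; the determinant of the
  vectors \<open>v\<close> and \<open>w\<close> is \<open>Im (cnj v * w)\<close>.\<close>

definition curvature :: "(real \<Rightarrow> complex) \<Rightarrow> real \<Rightarrow> real" where
  "curvature \<gamma> t =
     (let v = vector_derivative \<gamma> (at t);
          w = vector_derivative (\<lambda>s. vector_derivative \<gamma> (at s)) (at t)
      in Im (cnj v * w) / cmod v ^ 3)"

text \<open>The sign of the curvature depends on the orientation of the nodal curve, so the curvature at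
  \<open>z\<close> is given as a relation: \<open>k\<close> is the curvature at \<open>z\<close> of a nodal curve through \<open>z\<close>, computed
  in some regular parametrisation.\<close>

definition has_nodal_curvature :: "(complex \<Rightarrow> real) \<Rightarrow> real \<Rightarrow> complex \<Rightarrow> real \<Rightarrow> bool" where
  "has_nodal_curvature u r z k \<longleftrightarrow>
     (\<exists>C\<in>nodal_curves u r. \<exists>\<gamma> I. regular_analytic_param \<gamma> I \<and> \<gamma> ` I = C \<and>
        (\<exists>t\<in>I. \<gamma> t = z \<and> k = curvature \<gamma> t))"

lemma has_nodal_curvature_exists:
  assumes "only_nodal_curves_through_0 u r n" and "z \<in> nodal_set u r"
  shows "\<exists>k. has_nodal_curvature u r z k"
proof -
  obtain C where C: "C \<in> nodal_curves u r" "z \<in> C"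
    using assms by (auto simp: only_nodal_curves_through_0_def)
  then obtain \<gamma> I where "regular_analytic_param \<gamma> I" "C = \<gamma> ` I"
    by (auto simp: nodal_curves_def analytic_curves_in_def)
  with C show ?thesis
    unfolding has_nodal_curvature_def by blast
qed

end

theory Submission
  imports Defs "HOL-Complex_Analysis.Complex_Analysis"
begin

text \<open>Write \<open>u = Re f\<close> with \<open>f\<close> holomorphic and \<open>f 0 = 0\<close>. By the maximum principle the nodal set
  \<open>Z\<close> contains no cycles. Since every point of \<open>Z\<close> is joined to 0 by a nodal curve, \<open>f\<close> has no critical
  point on \<open>Z\<close> besides 0; hence \<open>Im f\<close> is strictly monotone along a nodal curve on either side of 0, \<open>f\<close>
  vanishes only at 0, and \<open>f = F ^ m\<close> with \<open>F\<close> holomorphic and \<open>F' 0 \<noteq> 0\<close>. Moreover \<open>F\<close> takes each value on a ray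
  \<open>Re (w ^ m) = 0\<close> at most once, along a curve running from 0 to the boundary. Comparing \<open>F\<close> with the
  values \<open>F\<close> takes where this curve meets three concentric circles, Schottky's theorem bounds
  \<open>F / F' 0\<close> near 0 by an absolute constant. Finally nodal curves are preimages of straight lines
  under \<open>F\<close>, so their curvature is at most \<open>\<bar>F'' / F'\<bar>\<close>.\<close>

subsection \<open>Acyclicity of the nodal set\<close>

text \<open>The bound must not depend on \<open>u\<close>, yet neither the injectivity of
  \<open>F\<close> nor its size off the nodal set is known. Known are the places where certain
  values are taken: if \<open>a\<close> is the value of \<open>F\<close> at a point
  \<open>z2\<close> over a ray, then \<open>F / a\<close> is 0 only at 0 and 1 only at
  \<open>z2\<close>, so it omits both on every annulus around 0 that avoids \<open>z2\<close>.
  Schottky's theorem concerns disks, so annuli are unrolled by \<open>exp\<close>. To cover all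
  angles by a disk of half radius, the unit disk has to be stretched by 2 pi, which asks for 2 pi of
  room in log |z| on both sides of a circle. As 2 pi < 7, the three circles have radii
  \<open>r * exp (-7)\<close>, \<open>r * exp (-14)\<close>, \<open>r * exp (-21)\<close>: the
  middle one carries \<open>z2\<close>, the outer one compares \<open>a\<close> with
  \<open>F' 0\<close>, the inner one compares \<open>F\<close> with \<open>a\<close>. The exponent
  \<open>m\<close> enters only through the direction of the ray. The topology rests on one fact:
  compact subsets of \<open>Z\<close> do not separate the plane, so by Janiszewski's theorem two
  continua in \<open>Z\<close> have a connected intersection.\<close>

locale holomorphic_nodal =
  fixes f :: "complex \<Rightarrow> complex" and r :: real
  assumes r_pos: "0 < r" and hol: "f holomorphic_on ball 0 r"
    and nonconst: "\<not> f constant_on ball 0 r" and f_0: "f 0 = 0"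
begin

definition Z :: "complex set" where
  "Z = {z \<in> ball 0 r. Re (f z) = 0}"

lemma Z_ball: "Z \<subseteq> ball 0 r"
  and zero_in_Z: "0 \<in> Z"
  using r_pos f_0 by (auto simp: Z_def)

text \<open>The frontier of \<open>inside K\<close> lies in \<open>K\<close>, so the maximum
  principle for \<open>f\<close> and \<open>- f\<close> forces \<open>Re f\<close> to vanish on
  \<open>inside K\<close>. The image of this open set would then lie in a line, against the open
  mapping theorem.\<close>

lemma connected_compl_compact:
  assumes "compact K" "K \<subseteq> Z"
  shows "connected (- K)"
proof -
  have K: "bounded K" "closed K" "K \<subseteq> ball 0 r"
    using assms Z_ball by (auto intro: compact_imp_bounded compact_imp_closed)
  have "inside K = {}"
  proof (rule ccontr)
    assume ne: "inside K \<noteq> {}"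
    have op: "open (inside K)"
      using K by (simp add: open_inside)
    have bd: "bounded (inside K)"
      using K by (simp add: bounded_inside)
    have "inside K \<subseteq> ball 0 r"
      using outside_subset_convex[of "ball 0 r" K] K(3) inside_Int_outside[of K] by (blast intro: convex_ball)
    moreover have fr: "frontier (inside K) \<subseteq> K"
      using K by (simp add: frontier_inside_subset)
    ultimately have cl: "closure (inside K) \<subseteq> ball 0 r"
      using K(3) by (auto simp: closure_Un_frontier)
    have sub: "inside K \<subseteq> ball 0 r" by fact
    have Re_fr: "Re (f z) = 0" if "z \<in> frontier (inside K)" for z
      using that fr assms(2) by (auto simp: Z_def)
    have h1: "f holomorphic_on interior (inside K)"
      using hol sub op by (simp add: holomorphic_on_subset interior_open)
    have c1: "continuous_on (closure (inside K)) f"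
      using hol cl by (blast intro: holomorphic_on_imp_continuous_on holomorphic_on_subset)
    have Re0: "Re (f z) = 0" if z: "z \<in> inside K" for z
    proof (rule antisym)
      show "Re (f z) \<le> 0"
        by (rule maximum_real_frontier[OF h1 c1 bd _ z]) (simp add: Re_fr)
      have "Re (- f z) \<le> 0"
        by (rule maximum_real_frontier[of "\<lambda>z. - f z", OF _ _ bd _ z])
           (use h1 c1 Re_fr in \<open>auto intro!: holomorphic_intros continuous_intros\<close>)
      then show "0 \<le> Re (f z)" by simp
    qed
    have "open (f ` inside K)"
      by (rule open_mapping_thm[OF hol]) (use op sub nonconst in auto)
    moreover obtain a where a: "a \<in> inside K" using ne by auto
    ultimately obtain e where e: "e > 0" "ball (f a) e \<subseteq> f ` inside K"
      by (meson imageI open_contains_ball)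
    have "f a + of_real (e / 2) \<in> ball (f a) e"
      using e by (simp add: dist_norm)
    then obtain b where "b \<in> inside K" "f b = f a + of_real (e / 2)"
      using e by (metis (no_types, lifting) image_iff subsetD)
    then show False using Re0[of a] Re0[of b] a e by simp
  qed
  then have "- K = outside K"
    using inside_Un_outside[of K] by simp
  then show ?thesis
    using connected_outside[OF K(1)] by simp
qed

text \<open>Janiszewski's theorem applies because \<open>S \<union> T\<close> is again a compact
  subset of \<open>Z\<close>. This is the form in which acyclicity is used: two arcs of
  \<open>Z\<close> with the same ends share a connected set containing both ends.\<close>

lemma connected_Int:
  assumes "compact S" "S \<subseteq> Z" "connected S" "compact T" "T \<subseteq> Z" "connected T"
  shows "connected (S \<inter> T)"
  using assms by (intro Janiszewski_dual connected_compl_compact) (auto intro: compact_Un)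

text \<open>A shortest loop, cut at its parameter midpoint, would give two continua in
  \<open>Z\<close> that meet in exactly two points. Local injectivity keeps loops from shrinking to
  a point, so a shortest one exists by compactness.\<close>

lemma nodal_path_inj:
  fixes \<gamma> :: "real \<Rightarrow> complex"
  assumes cont: "continuous_on I \<gamma>" and I: "is_interval I" and sub: "\<gamma> ` I \<subseteq> Z"
    and loc: "\<And>t. t \<in> I \<Longrightarrow> \<exists>e>0. inj_on \<gamma> (ball t e)"
  shows "inj_on \<gamma> I"
proof (rule ccontr)
  assume "\<not> inj_on \<gamma> I"
  then obtain s t where st: "s \<in> I" "t \<in> I" "s < t" "\<gamma> s = \<gamma> t"
    by (metis inj_on_def linorder_neqE)
  then have stI: "{s..t} \<subseteq> I"
    using I by (meson atLeastAtMost_iff mem_is_interval_1_I subsetI)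
  then have c: "continuous_on {s..t} \<gamma>"
    using cont continuous_on_subset by blast
  obtain e where e: "\<And>x. x \<in> I \<Longrightarrow> e x > 0 \<and> inj_on \<gamma> (ball x (e x))"
    using loc by metis
  \<comment> \<open>A Lebesgue number of the cover by injectivity balls; it bounds from below the
    parameter gap of any coincidence.\<close>
  obtain d where d: "d > 0" "\<And>x. x \<in> {s..t} \<Longrightarrow> \<exists>G\<in>((\<lambda>x. ball x (e x)) ` {s..t}). ball x d \<subseteq> G"
  proof (rule Heine_Borel_lemma[of "{s..t}" "(\<lambda>x. ball x (e x)) ` {s..t}"])
    show "{s..t} \<subseteq> \<Union> ((\<lambda>x. ball x (e x)) ` {s..t})"
    proof
      fix x assume "x \<in> {s..t}"
      moreover then have "x \<in> ball x (e x)" using e stI by auto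
      ultimately show "x \<in> \<Union> ((\<lambda>x. ball x (e x)) ` {s..t})" by blast
    qed
  qed (auto simp: image_iff)
  have far: "d \<le> y - x" if "x \<in> {s..t}" "y \<in> {s..t}" "x < y" "\<gamma> x = \<gamma> y" for x y
  proof (rule ccontr)
    assume "\<not> d \<le> y - x"
    then have "x \<in> ball x d" "y \<in> ball x d" using that d by (auto simp: dist_real_def)
    moreover have "\<exists>z\<in>{s..t}. ball x d \<subseteq> ball z (e z)"
      using d(2)[OF that(1)] by auto
    then obtain z where "z \<in> {s..t}" "ball x d \<subseteq> ball z (e z)" by blast
    ultimately show False
      using e[of z] stI that by (metis inj_onD less_irrefl subsetD)
  qed
  \<comment> \<open>By \<open>far\<close>, the condition \<open>d \<le> snd p - fst p\<close> loses
    no coincidence, and unlike \<open>fst p < snd p\<close> it is closed.\<close>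
  define P where "P = {p \<in> {s..t} \<times> {s..t}. \<gamma> (fst p) - \<gamma> (snd p) = 0} \<inter> {p. d \<le> snd p - fst p}"
  have "closed {p \<in> {s..t} \<times> {s..t}. \<gamma> (fst p) - \<gamma> (snd p) = 0}"
    by (intro continuous_closed_preimage_constant continuous_intros closed_Times
          continuous_on_compose2[OF c]) auto
  moreover have "bounded {p \<in> {s..t} \<times> {s..t}. \<gamma> (fst p) - \<gamma> (snd p) = 0}"
    by (rule bounded_subset[OF bounded_Times[OF bounded_closed_interval bounded_closed_interval]]) auto
  ultimately have "compact P" unfolding P_def
    by (intro compact_Int_closed closed_Collect_le continuous_intros)
       (auto simp: compact_eq_bounded_closed)
  moreover have "(s, t) \<in> P"
    using far[of s t] st by (auto simp: P_def)
  moreover have "continuous_on P (\<lambda>p. snd p - fst p)"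
    by (intro continuous_intros)
  ultimately obtain p where p: "p \<in> P" "\<And>q. q \<in> P \<Longrightarrow> snd p - fst p \<le> snd q - fst q"
    using continuous_attains_inf[of P "\<lambda>p. snd p - fst p"] by blast
  define x y where "x = fst p" and "y = snd p"
  have xy: "x \<in> {s..t}" "y \<in> {s..t}" "\<gamma> x = \<gamma> y" "x < y"
    using p(1) d(1) by (auto simp: P_def x_def y_def)
  have min: "y - x \<le> b - a" if "a \<in> {s..t}" "b \<in> {s..t}" "\<gamma> a = \<gamma> b" "a < b" for a b
    using p(2)[of "(a, b)"] far[of a b] that by (auto simp: P_def x_def y_def)
  define m where "m = (x + y) / 2"
  have m: "x < m" "m < y" using xy by (auto simp: m_def)
  have sub2: "{x..m} \<subseteq> {s..t}" "{m..y} \<subseteq> {s..t}" using xy m by auto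
  \<comment> \<open>A common value at parameters \<open>a < b\<close> has \<open>b - a\<close> at
    least \<open>y - x\<close> by minimality, which forces \<open>a = x\<close>; otherwise
    \<open>a = b = m\<close>.\<close>
  have eq: "\<gamma> ` {x..m} \<inter> \<gamma> ` {m..y} = {\<gamma> x, \<gamma> m}"
  proof
    show "{\<gamma> x, \<gamma> m} \<subseteq> \<gamma> ` {x..m} \<inter> \<gamma> ` {m..y}"
      using m xy by (auto intro: image_eqI[of _ _ x])
    show "\<gamma> ` {x..m} \<inter> \<gamma> ` {m..y} \<subseteq> {\<gamma> x, \<gamma> m}"
    proof
      fix w assume "w \<in> \<gamma> ` {x..m} \<inter> \<gamma> ` {m..y}"
      then obtain a b where ab: "a \<in> {x..m}" "b \<in> {m..y}" "w = \<gamma> a" "w = \<gamma> b" by blast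
      show "w \<in> {\<gamma> x, \<gamma> m}"
      proof (cases "a < b")
        case True
        then have "y - x \<le> b - a" using min[of a b] ab sub2 by auto
        then have "a = x" using ab by auto
        then show ?thesis using ab by auto
      next
        case False
        then have "a = m" using ab by auto
        then show ?thesis using ab by auto
      qed
    qed
  qed
  have "connected (\<gamma> ` {x..m} \<inter> \<gamma> ` {m..y})"
    by (intro connected_Int compact_continuous_image connected_continuous_image
        continuous_on_subset[OF c] sub2 subset_trans[OF image_mono sub] subset_trans[OF sub2(1) stI]
        subset_trans[OF sub2(2) stI]) auto
  then have "\<gamma> x = \<gamma> m"
    using connected_finite_iff_sing[of "{\<gamma> x, \<gamma> m}"] by (auto simp: eq doubleton_eq_iff)
  then show False using min[of x m] m xy sub2 by auto
qed

end

subsection \<open>Critical points on the nodal set\<close>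

text \<open>The power series of \<open>\<gamma>\<close> at \<open>t\<close> converges at real points
  up to distance \<open>e\<close>, hence on the complex disk of that radius. Local injectivity and
  second derivatives of \<open>\<gamma>\<close> can then be read off from the holomorphic
  \<open>G\<close>.\<close>

lemma regular_analytic_param_extend:
  assumes "regular_analytic_param \<gamma> I" "t \<in> I"
  obtains G e where "e > 0" "ball t e \<subseteq> I" "G holomorphic_on ball (of_real t) e"
    "\<And>s. s \<in> ball t e \<Longrightarrow> \<gamma> s = G (of_real s)"
    "\<And>s. s \<in> ball t e \<Longrightarrow> (\<gamma> has_vector_derivative deriv G (of_real s)) (at s)"
    "\<And>s. s \<in> ball t e \<Longrightarrow> deriv G (of_real s) \<noteq> 0"
proof -
  have "open I" and an: "\<gamma> real_analytic_on I" and reg: "\<And>t. t \<in> I \<Longrightarrow> vector_derivative \<gamma> (at t) \<noteq> 0"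
    using assms(1) by (auto simp: regular_analytic_param_def)
  obtain e1 where e1: "e1 > 0" "ball t e1 \<subseteq> I"
    using \<open>open I\<close> assms(2) openE by blast
  obtain a e2 where e2: "e2 > 0" "\<And>s. \<bar>s - t\<bar> < e2 \<Longrightarrow> (\<lambda>n. (s - t) ^ n *\<^sub>R a n) sums \<gamma> s"
    using an assms(2) unfolding real_analytic_on_def by blast
  define e where "e = min e1 e2"
  have e: "e > 0" "ball t e \<subseteq> I" using e1 e2(1) by (auto simp: e_def)
  define G where "G = (\<lambda>w. \<Sum>n. a n * (w - of_real t) ^ n)"
  have sums: "(\<lambda>n. a n * (w - of_real t) ^ n) sums G w" if w: "w \<in> ball (of_real t) e" for w
  proof -
    have "cmod (w - of_real t) < e" using w by (simp add: dist_norm norm_minus_commute)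
    then obtain x where x: "cmod (w - of_real t) < x" "x < e"
      using dense by blast
    then have "0 < x" using norm_ge_zero le_less_trans by blast
    have "\<bar>(t + x) - t\<bar> < e2" using x \<open>0 < x\<close> by (simp add: e_def)
    from e2(2)[OF this] have "summable (\<lambda>n. a n * (of_real x) ^ n)"
      by (simp add: sums_iff scaleR_conv_of_real mult.commute)
    then have "summable (\<lambda>n. a n * (w - of_real t) ^ n)"
      by (rule powser_inside) (use x \<open>0 < x\<close> in simp)
    then show ?thesis unfolding G_def by (rule summable_sums)
  qed
  have hol: "G holomorphic_on ball (of_real t) e"
    by (rule power_series_holomorphic[OF sums])
  have eq: "\<gamma> s = G (of_real s)" if "s \<in> ball t e" for s
  proof -
    have "\<bar>s - t\<bar> < e2" using that by (simp add: e_def dist_real_def abs_minus_commute)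
    from e2(2)[OF this] have "(\<lambda>n. a n * (of_real s - of_real t) ^ n) sums \<gamma> s"
      by (simp add: scaleR_conv_of_real mult.commute)
    moreover have "(\<lambda>n. a n * (of_real s - of_real t) ^ n) sums G (of_real s)"
      using that by (intro sums) (simp add: dist_norm flip: of_real_diff)
    ultimately show ?thesis by (rule sums_unique2)
  qed
  have der: "(\<gamma> has_vector_derivative deriv G (of_real s)) (at s)" if s: "s \<in> ball t e" for s
  proof -
    have "of_real s \<in> ball (of_real t :: complex) e"
      using s by (simp add: dist_norm flip: of_real_diff)
    then have "(G has_field_derivative deriv G (of_real s)) (at (of_real s))"
      using hol by (intro holomorphic_derivI) auto
    then have "((\<lambda>x. G (of_real x)) has_vector_derivative deriv G (of_real s)) (at s)"
      by (rule has_vector_derivative_real_field)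
    then show ?thesis
      by (rule has_vector_derivative_transform_within_open[of _ _ _ "ball t e"]) (use s eq in auto)
  qed
  then have "deriv G (of_real s) \<noteq> 0" if "s \<in> ball t e" for s
    using that reg[of s] e vector_derivative_at by fastforce
  then show ?thesis using that e hol eq der by blast
qed

text \<open>A derivative is asked for only at interior parameters: it serves for the direction in
  which an arc passes a point and for Rolle's theorem, while the ends need continuity only.\<close>

definition regular_arc :: "(real \<Rightarrow> complex) \<Rightarrow> real \<Rightarrow> real \<Rightarrow> bool" where
  "regular_arc \<gamma> a b \<longleftrightarrow> a < b \<and> continuous_on {a..b} \<gamma> \<and> inj_on \<gamma> {a..b} \<and>
     (\<forall>t\<in>{a<..<b}. \<exists>c. c \<noteq> 0 \<and> (\<gamma> has_vector_derivative c) (at t))"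

lemma regular_arc_reverse:
  assumes "regular_arc \<gamma> a b"
  shows "regular_arc (\<lambda>t. \<gamma> (- t)) (- b) (- a)"
  unfolding regular_arc_def
proof (intro conjI ballI)
  show "- b < - a" using assms by (simp add: regular_arc_def)
  show "continuous_on {- b..- a} (\<lambda>t. \<gamma> (- t))"
    by (rule continuous_on_compose2[of "{a..b}" \<gamma>])
       (use assms in \<open>auto simp: regular_arc_def intro!: continuous_intros\<close>)
  show "inj_on (\<lambda>t. \<gamma> (- t)) {- b..- a}"
  proof (rule inj_onI)
    fix x y assume "x \<in> {- b..- a}" "y \<in> {- b..- a}" "\<gamma> (- x) = \<gamma> (- y)"
    then have "- x = - y"
      using assms by (intro inj_onD[of \<gamma> "{a..b}"]) (auto simp: regular_arc_def)
    then show "x = y" by simp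
  qed
  fix t assume "t \<in> {- b<..<- a}"
  then have "- t \<in> {a<..<b}" by auto
  then obtain c where c: "c \<noteq> 0" "(\<gamma> has_vector_derivative c) (at (- t))"
    using assms unfolding regular_arc_def by blast
  have "((\<gamma> \<circ> uminus) has_vector_derivative (- 1) *\<^sub>R c) (at t)"
    by (rule vector_diff_chain_at) (use c in \<open>auto intro!: derivative_eq_intros\<close>)
  then show "\<exists>c. c \<noteq> 0 \<and> ((\<lambda>t. \<gamma> (- t)) has_vector_derivative c) (at t)"
    using c by (intro exI[of _ "- c"]) (simp add: o_def)
qed

text \<open>The number \<open>k\<close> is the order of \<open>f - f p\<close> at \<open>p\<close>.
  Factoring out the zero leaves a \<open>k\<close>-th root \<open>\<phi>\<close> with a simple zero,
  which is therefore a local coordinate with inverse \<open>\<psi>\<close>.\<close>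

lemma holomorphic_local_power:
  assumes hol: "f holomorphic_on ball 0 r" and nonconst: "\<not> f constant_on ball 0 r"
    and p: "p \<in> ball 0 r"
  obtains k :: nat and \<phi> \<psi> :: "complex \<Rightarrow> complex" and \<eta> V where
    "k > 0" "deriv f p = 0 \<Longrightarrow> k \<ge> 2" "\<eta> > 0" "open V" "p \<in> V" "V \<subseteq> ball 0 r"
    "\<phi> holomorphic_on V" "\<phi> p = 0" "deriv \<phi> p \<noteq> 0" "continuous_on (ball 0 \<eta>) \<psi>"
    "\<And>z. z \<in> V \<Longrightarrow> \<phi> z \<in> ball 0 \<eta> \<and> \<psi> (\<phi> z) = z \<and> f z - f p = \<phi> z ^ k"
    "\<And>w. w \<in> ball 0 \<eta> \<Longrightarrow> \<psi> w \<in> V \<and> \<phi> (\<psi> w) = w"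
proof -
  have "\<exists>n>0. (deriv ^^ n) f p \<noteq> 0"
  proof (rule ccontr)
    assume none: "\<not> ?thesis"
    then have zero: "(deriv ^^ n) f p = 0" if "0 < n" for n using that by blast
    have "f z = f p" if "z \<in> ball 0 r" for z
      by (rule holomorphic_fun_eq_const_on_connected[OF hol open_ball _ zero p that]) auto
    then show False using nonconst by (auto simp: constant_on_def)
  qed
  define k where "k = (LEAST n. n > 0 \<and> (deriv ^^ n) f p \<noteq> 0)"
  have k: "k > 0" "(deriv ^^ k) f p \<noteq> 0"
    using LeastI_ex[OF \<open>\<exists>n>0. (deriv ^^ n) f p \<noteq> 0\<close>] by (auto simp: k_def)
  have kmin: "(deriv ^^ i) f p = 0" if "0 < i" "i < k" for i
    using that not_less_Least[of i "\<lambda>n. n > 0 \<and> (deriv ^^ n) f p \<noteq> 0"] by (auto simp: k_def)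
  obtain g r' where g: "0 < r'" "g holomorphic_on ball p r'"
      "\<And>w. w \<in> ball p r' \<Longrightarrow> f w - f p = ((w - p) * g w) ^ k" "\<And>w. w \<in> ball p r' \<Longrightarrow> g w \<noteq> 0"
  proof (rule holomorphic_factor_order_of_zero_strong[OF hol open_ball p k])
    show "(deriv ^^ i) f p = 0" if "0 < i" "i < k" for i
      using kmin that by blast
  qed (rule that)
  obtain r'' where r'': "r'' > 0" "ball p r'' \<subseteq> ball 0 r"
    using p openE by blast
  define d0 where "d0 = min r' r''"
  have d0: "d0 > 0" "ball p d0 \<subseteq> ball p r'" "ball p d0 \<subseteq> ball 0 r"
    using g(1) r'' by (auto simp: d0_def)
  define \<phi> where "\<phi> = (\<lambda>w. (w - p) * g w)"
  have hol\<phi>: "\<phi> holomorphic_on ball p d0"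
    unfolding \<phi>_def using d0 by (intro holomorphic_intros holomorphic_on_subset[OF g(2)])
  have "(g has_field_derivative deriv g p) (at p)"
    using g by (intro holomorphic_derivI[OF g(2)]) auto
  then have "(\<phi> has_field_derivative g p) (at p)"
    unfolding \<phi>_def by (auto intro!: derivative_eq_intros)
  then have der: "deriv \<phi> p = g p" by (rule DERIV_imp_deriv)
  have dnz: "deriv \<phi> p \<noteq> 0" using g d0 by (simp add: der)
  obtain d where d: "d > 0" "ball p d \<subseteq> ball p d0" "inj_on \<phi> (ball p d)"
    by (rule has_complex_derivative_locally_injective[OF hol\<phi> _ open_ball dnz]) (use d0 in auto)
  have hold: "\<phi> holomorphic_on ball p d"
    using hol\<phi> d(2) holomorphic_on_subset by blast
  obtain \<psi> where \<psi>: "\<psi> holomorphic_on \<phi> ` ball p d" "\<And>z. z \<in> ball p d \<Longrightarrow> \<psi> (\<phi> z) = z"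
    using holomorphic_has_inverse[OF hold open_ball d(3)] by metis
  have "open (\<phi> ` ball p d)"
    by (rule open_mapping_thm3[OF hold open_ball d(3)])
  moreover have "0 \<in> \<phi> ` ball p d"
    using d(1) by (intro image_eqI[of _ _ p]) (auto simp: \<phi>_def)
  ultimately obtain \<eta> where \<eta>: "\<eta> > 0" "ball 0 \<eta> \<subseteq> \<phi> ` ball p d"
    using openE by blast
  \<comment> \<open>Cut down so that \<open>\<phi>\<close> maps \<open>V\<close> onto a round disk;
    every radius of the disk then lifts to \<open>V\<close>.\<close>
  define V where "V = ball p d \<inter> \<phi> -` ball 0 \<eta>"
  show ?thesis
  proof
    show "k > 0" by fact
    show "k \<ge> 2" if "deriv f p = 0"
      using k that by (cases "k = 1") auto
    show "\<eta> > 0" by fact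
    show "open V" unfolding V_def
      by (intro continuous_open_preimage holomorphic_on_imp_continuous_on hold) auto
    show "p \<in> V" using d \<eta> by (auto simp: V_def \<phi>_def)
    show "V \<subseteq> ball 0 r" using d d0 by (auto simp: V_def)
    show "\<phi> holomorphic_on V" using hold by (rule holomorphic_on_subset) (auto simp: V_def)
    show "\<phi> p = 0" by (simp add: \<phi>_def)
    show "deriv \<phi> p \<noteq> 0" by fact
    show "continuous_on (ball 0 \<eta>) \<psi>"
      using \<psi>(1) \<eta>(2) by (blast intro: holomorphic_on_imp_continuous_on holomorphic_on_subset)
    show "\<phi> z \<in> ball 0 \<eta> \<and> \<psi> (\<phi> z) = z \<and> f z - f p = \<phi> z ^ k" if "z \<in> V" for z
    proof -
      have "z \<in> ball p d" "z \<in> ball p r'" using that d(2) d0(2) unfolding V_def by blast+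
      then show ?thesis using that \<psi>(2) g(3) by (auto simp: V_def \<phi>_def)
    qed
    show "\<psi> w \<in> V \<and> \<phi> (\<psi> w) = w" if w: "w \<in> ball 0 \<eta>" for w
    proof -
      obtain z where "z \<in> ball p d" "w = \<phi> z" using w \<eta>(2) by blast
      then show ?thesis using w \<psi>(2) by (auto simp: V_def)
    qed
  qed
qed

context holomorphic_nodal
begin

text \<open>Local injectivity comes from \<open>deriv G \<noteq> 0\<close> for the holomorphic
  extension, and \<open>nodal_path_inj\<close> makes it global: a nodal curve neither closes up nor
  crosses itself.\<close>

lemma nodal_param_inj:
  assumes \<gamma>: "regular_analytic_param \<gamma> I" and sub: "\<gamma> ` I \<subseteq> Z"
  shows "inj_on \<gamma> I" and "continuous_on I \<gamma>"
proof -
  have der: "\<exists>c. c \<noteq> 0 \<and> (\<gamma> has_vector_derivative c) (at t)" if "t \<in> I" for t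
    by (rule regular_analytic_param_extend[OF \<gamma> that]) (metis centre_in_ball)
  show c: "continuous_on I \<gamma>"
    using der by (meson continuous_at_imp_continuous_on has_vector_derivative_continuous)
  show "inj_on \<gamma> I"
  proof (rule nodal_path_inj[OF c _ sub])
    show "is_interval I" using \<gamma> by (simp add: regular_analytic_param_def)
    fix t assume t: "t \<in> I"
    obtain G e where G: "e > 0" "G holomorphic_on ball (of_real t) e"
      "\<And>s. s \<in> ball t e \<Longrightarrow> \<gamma> s = G (of_real s)" "\<And>s. s \<in> ball t e \<Longrightarrow> deriv G (of_real s) \<noteq> 0"
      by (rule regular_analytic_param_extend[OF \<gamma> t]) blast
    obtain d where d: "d > 0" "ball (of_real t) d \<subseteq> ball (of_real t :: complex) e" "inj_on G (ball (of_real t) d)"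
      by (rule has_complex_derivative_locally_injective[OF G(2) _ open_ball, of "of_real t"]) (use G in auto)
    have "inj_on \<gamma> (ball t (min d e))"
    proof (rule inj_onI)
      fix x y assume xy: "x \<in> ball t (min d e)" "y \<in> ball t (min d e)" "\<gamma> x = \<gamma> y"
      then have "complex_of_real x \<in> ball (of_real t) d" "complex_of_real y \<in> ball (of_real t) d"
        by (auto simp: dist_norm simp flip: of_real_diff)
      moreover have "G (of_real x) = G (of_real y)" using xy G(3) by auto
      ultimately show "x = y" using inj_onD[OF d(3)] of_real_eq_iff by blast
    qed
    then show "\<exists>e>0. inj_on \<gamma> (ball t e)"
      using d(1) G(1) by (intro exI[of _ "min d e"]) auto
  qed
qed

end

text \<open>The form in which it is used that all nodal curves pass through 0: each nodal point is
  joined to 0 inside \<open>Z\<close> along one regular analytic curve.\<close>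

locale star_shaped_nodal = holomorphic_nodal +
  assumes curves: "\<And>w. w \<in> Z \<Longrightarrow>
    \<exists>\<gamma> I. regular_analytic_param \<gamma> I \<and> \<gamma> ` I \<subseteq> Z \<and> w \<in> \<gamma> ` I \<and> 0 \<in> \<gamma> ` I"
begin

lemma nodal_arc:
  assumes "w \<in> Z" "w \<noteq> 0"
  obtains \<gamma> a b where "regular_arc \<gamma> a b" "\<gamma> ` {a..b} \<subseteq> Z" "\<gamma> a = w" "\<gamma> b = 0"
proof -
  obtain \<gamma> I s t where \<gamma>: "regular_analytic_param \<gamma> I" "\<gamma> ` I \<subseteq> Z" "s \<in> I" "t \<in> I" "\<gamma> s = w" "\<gamma> t = 0"
    using curves[OF assms(1)] by (metis imageE)
  have int: "is_interval I" using \<gamma> by (simp add: regular_analytic_param_def)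
  have arc: "regular_arc \<gamma> x y \<and> \<gamma> ` {x..y} \<subseteq> Z" if "x \<in> I" "y \<in> I" "x < y" for x y
  proof -
    have sub: "{x..y} \<subseteq> I" using that int
      by (meson atLeastAtMost_iff mem_is_interval_1_I subsetI)
    have "\<exists>c. c \<noteq> 0 \<and> (\<gamma> has_vector_derivative c) (at t)" if "t \<in> {x<..<y}" for t
    proof -
      have "t \<in> I" using that sub by auto
      then show ?thesis by (rule regular_analytic_param_extend[OF \<gamma>(1)]) (metis centre_in_ball)
    qed
    then show ?thesis using nodal_param_inj[OF \<gamma>(1,2)] sub \<gamma>(2) that(3)
      by (auto simp: regular_arc_def intro: continuous_on_subset inj_on_subset)
  qed
  consider "s < t" | "t < s" using \<gamma>(5,6) assms(2) by fastforce
  then show ?thesis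
  proof cases
    case 1
    then show ?thesis using that[of \<gamma> s t] arc[of s t] \<gamma> by blast
  next
    case 2
    have "(\<lambda>u. \<gamma> (- u)) ` {- s..- t} \<subseteq> \<gamma> ` {t..s}" by auto
    then show ?thesis
      using that[of "\<lambda>u. \<gamma> (- u)" "- s" "- t"] arc[of t s] regular_arc_reverse[of \<gamma> t s] \<gamma> 2 by auto
  qed
qed

end

text \<open>These unit vectors are the directions of the rays on which
  \<open>Re (w ^ k) = 0\<close>. Writing them as roots allows them to be counted; their finiteness
  makes a continuous direction along a nodal arc constant.\<close>

lemma unit_imaginary_roots_eq:
  assumes "k > 0"
  shows "{e. cmod e = 1 \<and> Re (e ^ k) = 0} = {z. z ^ k = \<i>} \<union> {z. z ^ k = - \<i>}"
proof (intro equalityI subsetI)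
  fix e assume "e \<in> {e. cmod e = 1 \<and> Re (e ^ k) = 0}"
  then have "cmod (e ^ k) = 1" "Re (e ^ k) = 0" by (auto simp: norm_power)
  then have "\<bar>Im (e ^ k)\<bar> = 1" by (simp add: cmod_eq_Im)
  then have "Im (e ^ k) = 1 \<or> Im (e ^ k) = - 1" by linarith
  then show "e \<in> {z. z ^ k = \<i>} \<union> {z. z ^ k = - \<i>}"
    using \<open>Re (e ^ k) = 0\<close> by (auto simp: complex_eq_iff)
next
  fix e :: complex assume "e \<in> {z. z ^ k = \<i>} \<union> {z. z ^ k = - \<i>}"
  then have e: "e ^ k = \<i> \<or> e ^ k = - \<i>" by auto
  then have "cmod (e ^ k) = 1" "Re (e ^ k) = 0" by auto
  moreover from this have "cmod e = 1"
    using power_eq_imp_eq_base[of "cmod e" k 1] assms by (simp add: norm_power)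
  ultimately show "e \<in> {e. cmod e = 1 \<and> Re (e ^ k) = 0}" by simp
qed

lemma finite_unit_imaginary_roots:
  assumes "k > 0"
  shows "finite {e. cmod e = 1 \<and> Re (e ^ k) = 0}"
  unfolding unit_imaginary_roots_eq[OF assms] using assms by (simp add: finite_nth_roots)

lemma has_vector_derivative_quotient:
  assumes "(f has_vector_derivative D) (at x)"
  shows "((\<lambda>t. (f t - f x) /\<^sub>R (t - x)) \<longlongrightarrow> D) (at x)"
proof -
  have "((\<lambda>t. ((f t - f x) - (t - x) *\<^sub>R D) /\<^sub>R norm (t - x)) \<longlongrightarrow> 0) (at x)"
    using assms by (simp add: has_vector_derivative_def has_derivative_at_within)
  then have "((\<lambda>t. (f t - f x) /\<^sub>R (t - x) - D) \<longlongrightarrow> 0) (at x)"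
  proof (rule Lim_null_comparison[rotated, OF tendsto_norm_zero])
    show "\<forall>\<^sub>F t in at x. norm ((f t - f x) /\<^sub>R (t - x) - D) \<le>
        norm (((f t - f x) - (t - x) *\<^sub>R D) /\<^sub>R norm (t - x))"
      using eventually_neq_at_within[of x]
    proof eventually_elim
      case (elim t)
      then have "(f t - f x) /\<^sub>R (t - x) - D = ((f t - f x) - (t - x) *\<^sub>R D) /\<^sub>R (t - x)"
        by (simp add: scaleR_diff_right)
      then show ?case by simp
    qed
  qed
  then show ?thesis by (simp add: LIM_zero_iff)
qed

context star_shaped_nodal
begin

text \<open>At a critical point \<open>p \<noteq> 0\<close> at least four arcs of \<open>Z\<close> would emanate. Every arc of \<open>Z\<close> near
  \<open>p\<close> is joined to 0 by a regular arc, which avoids \<open>p\<close> or passes straight through it. Either way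
  some arc at \<open>p\<close>, with the same tangent line, is joined to 0 inside \<open>Z - {p}\<close>; as \<open>Z\<close> contains no
  cycles, it is always the same one.\<close>

lemma deriv_nonzero:
  assumes p: "p \<in> Z" "p \<noteq> 0"
  shows "deriv f p \<noteq> 0"
proof
  assume crit: "deriv f p = 0"
  have "p \<in> ball 0 r" using p Z_ball by blast
  obtain k \<phi> \<psi> \<eta> V where k: "k > 0" "deriv f p = 0 \<Longrightarrow> k \<ge> 2" and \<eta>: "\<eta> > 0"
    and V: "open V" "p \<in> V" "V \<subseteq> ball 0 r" and \<phi>: "\<phi> holomorphic_on V" "\<phi> p = 0" "deriv \<phi> p \<noteq> 0"
    and cont\<psi>: "continuous_on (ball 0 \<eta>) \<psi>"
    and \<phi>V: "\<And>z. z \<in> V \<Longrightarrow> \<phi> z \<in> ball 0 \<eta> \<and> \<psi> (\<phi> z) = z \<and> f z - f p = \<phi> z ^ k"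
    and \<psi>B: "\<And>w. w \<in> ball 0 \<eta> \<Longrightarrow> \<psi> w \<in> V \<and> \<phi> (\<psi> w) = w"
  proof (rule holomorphic_local_power[OF hol nonconst \<open>p \<in> ball 0 r\<close>])
  qed (rule that)
  have k2: "k \<ge> 2" using k crit by simp
  have Rep: "Re (f p) = 0" using p by (simp add: Z_def)
  have inZ: "z \<in> Z \<longleftrightarrow> Re (\<phi> z ^ k) = 0" if "z \<in> V" for z
  proof -
    have "f z = f p + \<phi> z ^ k" using \<phi>V[OF that] by (metis add.commute diff_add_cancel)
    then show ?thesis using that V Rep by (auto simp: Z_def)
  qed
  have \<phi>nz: "\<phi> z \<noteq> 0" if "z \<in> V" "z \<noteq> p" for z
    using \<phi>V[OF that(1)] \<phi>V[OF V(2)] that(2) \<phi>(2) by metis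
  have Re_of_real_mult: "Re (of_real a * z) = a * Re z" for a z by simp
  \<comment> \<open>In the coordinate \<open>\<phi>\<close> the nodal set near \<open>p\<close> is a
    star whose arms point in the directions of \<open>E\<close>. There are \<open>2 * k\<close> of
    them, hence at least four at a critical point.\<close>
  define E where "E = {e. cmod e = 1 \<and> Re (e ^ k) = 0}"
  have E_iff: "E = {z. z ^ k = \<i>} \<union> {z. z ^ k = - \<i>}"
    unfolding E_def by (rule unit_imaginary_roots_eq[OF k(1)])
  have finE: "finite E" unfolding E_def by (rule finite_unit_imaginary_roots[OF k(1)])
  have "card E = k + k"
    unfolding E_iff by (subst card_Un_disjoint) (use k(1) in \<open>auto simp: card_nth_roots finite_nth_roots\<close>)
  then have cardE: "card E \<ge> 4" using k2 by simp
  have negE: "- e \<in> E" if "e \<in> E" for e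
    using that by (cases "even k") (auto simp: E_def power_minus_odd)
  have E0: "e \<noteq> 0" if "e \<in> E" for e using that by (auto simp: E_def)
  have sgnE: "sgn (of_real x * e) = e" if "e \<in> E" "x > 0" for x e
    using that by (simp add: sgn_div_norm norm_mult E_def scaleR_conv_of_real)
  have arm_ball: "of_real x * e \<in> ball 0 \<eta>" if "e \<in> E" "0 \<le> x" "x < \<eta>" for x e
    using that by (simp add: norm_mult E_def)
  have arm: "\<psi> (of_real x * e) \<in> Z" if "e \<in> E" "0 \<le> x" "x < \<eta>" for x e
  proof -
    have "(of_real x * e) ^ k = of_real (x ^ k) * e ^ k" by (simp add: power_mult_distrib)
    then have "Re ((of_real x * e) ^ k) = x ^ k * Re (e ^ k)" by (simp only: Re_of_real_mult)
    then show ?thesis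
      using inZ[of "\<psi> (of_real x * e)"] \<psi>B[OF arm_ball[OF that]] that by (simp add: E_def)
  qed
  have ray: "sgn (\<phi> z) \<in> E" if "z \<in> Z" "z \<in> V" "z \<noteq> p" for z
  proof -
    have nz: "\<phi> z \<noteq> 0" using \<phi>nz that by blast
    have "sgn (\<phi> z) ^ k = of_real ((1 / cmod (\<phi> z)) ^ k) * \<phi> z ^ k"
      by (simp add: sgn_eq power_divide)
    then have "Re (sgn (\<phi> z) ^ k) = (1 / cmod (\<phi> z)) ^ k * Re (\<phi> z ^ k)"
      by (simp only: Re_of_real_mult)
    then show ?thesis using inZ[OF that(2)] that nz by (simp add: E_def norm_sgn)
  qed
  define seg where "seg = (\<lambda>e x. closed_segment 0 (of_real x * e :: complex))"
  have seg_elem: "\<exists>y. 0 \<le> y \<and> y \<le> x \<and> w = of_real y * e" if w: "w \<in> seg e x" "0 < x" for w e x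
  proof -
    obtain u where "0 \<le> u" "u \<le> 1" "w = u *\<^sub>R (of_real x * e)"
      using w by (auto simp: seg_def in_segment)
    then show ?thesis using w(2)
      by (intro exI[of _ "u * x"]) (auto simp: scaleR_conv_of_real mult_left_le_one_le)
  qed
  have seg_ball: "seg e x \<subseteq> ball 0 \<eta>" if "e \<in> E" "0 < x" "x < \<eta>" for e x
    unfolding seg_def by (rule closed_segment_subset) (use that \<eta> arm_ball[of e x] in auto)
  have seg_Z: "\<psi> ` seg e x \<subseteq> Z" if "e \<in> E" "0 < x" "x < \<eta>" for e x
    using seg_elem that arm by fastforce
  have segs: "compact (seg e x)" "connected (seg e x)" "0 \<in> seg e x" "of_real x * e \<in> seg e x" for e x
    by (auto simp: seg_def)
  \<comment> \<open>Two arms joined to each other inside \<open>Z - {p}\<close> coincide: the wedge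
    \<open>L\<close> of the two arms, lifted by \<open>\<psi>\<close>, meets \<open>T\<close> in a
    connected set that avoids \<open>p\<close>. On it the direction of \<open>\<phi>\<close> is
    continuous with values in \<open>{e1, e2}\<close>, and it takes both.\<close>
  have key1: "e1 = e2"
    if e: "e1 \<in> E" "e2 \<in> E" and x: "0 < x1" "x1 < \<eta>" "0 < x2" "x2 < \<eta>"
      and T: "compact T" "connected T" "T \<subseteq> Z" "p \<notin> T" "\<psi> (of_real x1 * e1) \<in> T" "\<psi> (of_real x2 * e2) \<in> T"
    for e1 e2 x1 x2 T
  proof -
    define L where "L = seg e1 x1 \<union> seg e2 x2"
    have L: "L \<subseteq> ball 0 \<eta>" "compact L" "connected L" "\<psi> ` L \<subseteq> Z"
    proof -
      show "L \<subseteq> ball 0 \<eta>" "\<psi> ` L \<subseteq> Z" "compact L"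
        unfolding L_def image_Un using seg_ball seg_Z e x segs(1) by (simp_all add: compact_Un)
      show "connected L"
        unfolding L_def using segs(2,3) by (intro connected_Un) blast+
    qed
    have contL: "continuous_on L \<psi>" using cont\<psi> L(1) continuous_on_subset by blast
    define X where "X = \<psi> ` L \<inter> T"
    have "connected X" unfolding X_def
      by (intro connected_Int compact_continuous_image connected_continuous_image L contL T)
    have XV: "X \<subseteq> V" using \<psi>B L(1) by (auto simp: X_def)
    have X0: "\<phi> z \<noteq> 0" if "z \<in> X" for z
      using \<phi>nz that XV T(4) by (auto simp: X_def)
    have "continuous_on X (\<lambda>z. sgn (\<phi> z))"
      using XV X0 by (intro continuous_on_sgn continuous_on_subset[OF holomorphic_on_imp_continuous_on[OF \<phi>(1)]]) auto
    then have con: "connected ((\<lambda>z. sgn (\<phi> z)) ` X)"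
      using \<open>connected X\<close> connected_continuous_image by blast
    have "sgn (\<phi> z) \<in> {e1, e2}" if z: "z \<in> X" for z
    proof -
      obtain w where w: "w \<in> L" "z = \<psi> w" using z by (auto simp: X_def)
      then have "\<phi> z = w" using \<psi>B L(1) by blast
      obtain y e where y: "0 \<le> y" "w = of_real y * e" "e \<in> {e1, e2}"
        using w(1) seg_elem x unfolding L_def by blast
      have "y \<noteq> 0" using X0[OF z] \<open>\<phi> z = w\<close> y by auto
      then have "sgn w = e" using y e sgnE[of e y] by auto
      then show ?thesis using y \<open>\<phi> z = w\<close> by simp
    qed
    then have "(\<lambda>z. sgn (\<phi> z)) ` X \<subseteq> {e1, e2}" by blast
    then have "finite ((\<lambda>z. sgn (\<phi> z)) ` X)" by (rule finite_subset) simp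
    moreover have "e1 \<in> (\<lambda>z. sgn (\<phi> z)) ` X" "e2 \<in> (\<lambda>z. sgn (\<phi> z)) ` X"
    proof -
      have a: "sgn (\<phi> (\<psi> (of_real x1 * e1))) = e1" "sgn (\<phi> (\<psi> (of_real x2 * e2))) = e2"
        using \<psi>B arm_ball sgnE e x by auto
      have "\<psi> (of_real x1 * e1) \<in> X" "\<psi> (of_real x2 * e2) \<in> X"
        using segs T by (auto simp: X_def L_def)
      then show "e1 \<in> (\<lambda>z. sgn (\<phi> z)) ` X" "e2 \<in> (\<lambda>z. sgn (\<phi> z)) ` X"
        using a by (metis (no_types, lifting) image_eqI)+
    qed
    ultimately show "e1 = e2"
      using connected_finite_iff_sing[OF con] by (metis empty_iff singletonD)
  qed
  \<comment> \<open>The secant directions converge to that of \<open>C\<close> and lie in the finite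
    set \<open>E\<close>, so they are eventually constant. Dividing by \<open>t - \<tau>\<close>
    reverses the sign before \<open>\<tau>\<close>: the arc comes in along the arm
    \<open>- e\<close> and leaves along \<open>e\<close>.\<close>
  have dir: "\<exists>e\<in>E. \<exists>d>0. \<forall>t. (\<tau> < t \<and> t < \<tau> + d \<longrightarrow> \<gamma> t \<in> V \<and> sgn (\<phi> (\<gamma> t)) = e) \<and>
        (\<tau> - d < t \<and> t < \<tau> \<longrightarrow> \<gamma> t \<in> V \<and> sgn (\<phi> (\<gamma> t)) = - e)"
    if \<gamma>: "regular_arc \<gamma> a b" "\<gamma> ` {a..b} \<subseteq> Z" and \<tau>: "a < \<tau>" "\<tau> < b" "\<gamma> \<tau> = p" for \<gamma> a b \<tau>
  proof -
    obtain c where c: "c \<noteq> 0" "(\<gamma> has_vector_derivative c) (at \<tau>)"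
      using \<gamma>(1) \<tau> unfolding regular_arc_def by (meson greaterThanLessThan_iff)
    define C where "C = c * deriv \<phi> p"
    have "C \<noteq> 0" using c \<phi> by (simp add: C_def)
    have "(\<phi> has_field_derivative deriv \<phi> p) (at (\<gamma> \<tau>))"
      using holomorphic_derivI[OF \<phi>(1) V(1,2)] \<tau>(3) by simp
    then have "(\<phi> \<circ> \<gamma> has_vector_derivative C) (at \<tau>)"
      unfolding C_def by (rule field_vector_diff_chain_at[OF c(2)])
    then have "((\<lambda>t. (\<phi> (\<gamma> t) - \<phi> (\<gamma> \<tau>)) /\<^sub>R (t - \<tau>)) \<longlongrightarrow> C) (at \<tau>)"
      using has_vector_derivative_quotient[of "\<phi> \<circ> \<gamma>"] by simp
    then have lim: "((\<lambda>t. sgn (\<phi> (\<gamma> t) /\<^sub>R (t - \<tau>))) \<longlongrightarrow> sgn C) (at \<tau>)"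
      using \<open>C \<noteq> 0\<close> \<tau>(3) \<phi>(2) by (intro tendsto_sgn) auto
    have ev1: "\<forall>\<^sub>F t in at \<tau>. t \<in> {a<..<b}"
      using \<tau> by (intro eventually_at_in_open') auto
    have "isCont \<gamma> \<tau>" using c(2) has_vector_derivative_continuous by blast
    then have ev2: "\<forall>\<^sub>F t in at \<tau>. \<gamma> t \<in> V"
      using V \<tau>(3) by (metis isContD topological_tendstoD)
    have evE: "\<forall>\<^sub>F t in at \<tau>. sgn (\<phi> (\<gamma> t) /\<^sub>R (t - \<tau>)) \<in> E"
      using ev1 ev2 eventually_neq_at_within[of \<tau>]
    proof eventually_elim
      case (elim t)
      have "\<gamma> t \<noteq> p"
        using \<gamma>(1) elim \<tau> unfolding regular_arc_def
        by (metis atLeastAtMost_iff greaterThanLessThan_iff inj_onD less_imp_le)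
      then have "sgn (\<phi> (\<gamma> t)) \<in> E" using elim \<gamma>(2) by (intro ray) auto
      then show ?case using elim negE by (auto simp: sgn_scaleR sgn_if)
    qed
    have "sgn C \<in> E"
      by (rule Lim_in_closed_set[OF finite_imp_closed[OF finE] evE _ lim]) simp
    have "\<forall>\<^sub>F t in at \<tau>. sgn (\<phi> (\<gamma> t) /\<^sub>R (t - \<tau>)) \<in> - (E - {sgn C})"
    proof (rule topological_tendstoD[OF lim])
      show "open (- (E - {sgn C}))"
        using finE by (intro open_Compl finite_imp_closed) simp
    qed simp
    with evE ev2 have "\<forall>\<^sub>F t in at \<tau>. \<gamma> t \<in> V \<and> sgn (\<phi> (\<gamma> t) /\<^sub>R (t - \<tau>)) = sgn C"
      by eventually_elim auto
    then obtain d where d: "d > 0"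
      "\<And>t. t \<noteq> \<tau> \<Longrightarrow> dist t \<tau> < d \<Longrightarrow> \<gamma> t \<in> V \<and> sgn (\<phi> (\<gamma> t) /\<^sub>R (t - \<tau>)) = sgn C"
      unfolding eventually_at by auto
    show ?thesis
    proof (rule bexI[OF _ \<open>sgn C \<in> E\<close>], rule exI[of _ d], intro conjI allI)
      fix t
      show "\<tau> < t \<and> t < \<tau> + d \<longrightarrow> \<gamma> t \<in> V \<and> sgn (\<phi> (\<gamma> t)) = sgn C"
        using d(2)[of t] by (auto simp: dist_real_def sgn_scaleR)
      show "\<tau> - d < t \<and> t < \<tau> \<longrightarrow> \<gamma> t \<in> V \<and> sgn (\<phi> (\<gamma> t)) = - sgn C"
        using d(2)[of t] by (auto simp: dist_real_def sgn_scaleR minus_equation_iff)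
    qed fact
  qed
  \<comment> \<open>Start from a point \<open>w\<close> on the arm \<open>e\<close> and follow an
    arc to 0. If it misses \<open>p\<close>, the arm \<open>e\<close> itself is joined to 0 off
    \<open>p\<close>; if it runs through \<open>p\<close>, the part after \<open>p\<close> joins the
    opposite arm to 0.\<close>
  have access: "\<exists>e'\<in>E. (e = e' \<or> e = - e') \<and> (\<exists>T x. compact T \<and> connected T \<and> T \<subseteq> Z \<and> p \<notin> T \<and> 0 \<in> T \<and>
        0 < x \<and> x < \<eta> \<and> \<psi> (of_real x * e') \<in> T)" if e: "e \<in> E" for e
  proof -
    define w where "w = \<psi> (of_real (\<eta> / 2) * e)"
    have wZ: "w \<in> Z" unfolding w_def using e \<eta> by (intro arm) auto
    have \<phi>w: "\<phi> w = of_real (\<eta> / 2) * e" "w \<in> V"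
      using \<psi>B[OF arm_ball[OF e, of "\<eta> / 2"]] \<eta> unfolding w_def by auto
    then have wp: "w \<noteq> p" using \<phi>(2) E0[OF e] \<eta> by auto
    show ?thesis
    proof (cases "w = 0")
      case True
      then show ?thesis
        using e \<eta> p zero_in_Z
        by (intro bexI[OF _ e] conjI disjI1 refl exI[of _ "{0}"] exI[of _ "\<eta> / 2"]) (auto simp: w_def)
    next
      case False
      obtain \<gamma> a b where \<gamma>: "regular_arc \<gamma> a b" "\<gamma> ` {a..b} \<subseteq> Z" "\<gamma> a = w" "\<gamma> b = 0"
        by (rule nodal_arc[OF wZ False])
      have ab: "a < b" and cont\<gamma>: "continuous_on {a..b} \<gamma>" and inj: "inj_on \<gamma> {a..b}"
        using \<gamma>(1) by (auto simp: regular_arc_def)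
      have sub: "compact (\<gamma> ` {s..t}) \<and> connected (\<gamma> ` {s..t}) \<and> \<gamma> ` {s..t} \<subseteq> Z" if "a \<le> s" "t \<le> b" for s t
      proof -
        have "{s..t} \<subseteq> {a..b}" using that by auto
        then show ?thesis
          using cont\<gamma> \<gamma>(2) by (meson compact_Icc compact_continuous_image connected_Icc
              connected_continuous_image continuous_on_subset image_mono subset_trans)
      qed
      show ?thesis
      proof (cases "p \<in> \<gamma> ` {a..b}")
        case False
        have "w \<in> \<gamma> ` {a..b}" "0 \<in> \<gamma> ` {a..b}" using ab \<gamma>(3,4) by force+
        then show ?thesis
          using e \<eta> sub[of a b] False
          by (intro bexI[OF _ e] conjI disjI1 refl exI[of _ "\<gamma> ` {a..b}"] exI[of _ "\<eta> / 2"]) (auto simp: w_def)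
      next
        case True
        then obtain \<tau> where "\<tau> \<in> {a..b}" "\<gamma> \<tau> = p" by blast
        then have \<tau>: "a < \<tau>" "\<tau> < b" "\<gamma> \<tau> = p"
          using \<gamma>(3,4) wp p(2) by (auto simp: order_less_le)
        obtain e1 d where e1: "e1 \<in> E" "d > 0"
          and after: "\<And>t. \<tau> < t \<Longrightarrow> t < \<tau> + d \<Longrightarrow> \<gamma> t \<in> V \<and> sgn (\<phi> (\<gamma> t)) = e1"
          and before: "\<And>t. \<tau> - d < t \<Longrightarrow> t < \<tau> \<Longrightarrow> \<gamma> t \<in> V \<and> sgn (\<phi> (\<gamma> t)) = - e1"
          using dir[OF \<gamma>(1,2) \<tau>] by blast
        obtain t' where t': "\<tau> < t'" "t' < min b (\<tau> + d)"
          using dense[of \<tau> "min b (\<tau> + d)"] \<tau> e1 by auto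
        define x where "x = cmod (\<phi> (\<gamma> t'))"
        have t'V: "\<gamma> t' \<in> V" "sgn (\<phi> (\<gamma> t')) = e1" using after t' by auto
        have "\<gamma> t' \<noteq> p" using inj_onD[OF inj, of t' \<tau>] t' \<tau> by auto
        then have x: "0 < x" "x < \<eta>" using \<phi>nz t'V \<phi>V[of "\<gamma> t'"] by (auto simp: x_def)
        have "of_real x * e1 = \<phi> (\<gamma> t')"
          using t'V(2) x by (auto simp: x_def sgn_eq)
        then have "\<psi> (of_real x * e1) = \<gamma> t'" using \<phi>V t'V by simp
        moreover have "p \<notin> \<gamma> ` {t'..b}"
        proof
          assume "p \<in> \<gamma> ` {t'..b}"
          then obtain s where "s \<in> {t'..b}" "\<gamma> s = p" by auto
          then show False using inj_onD[OF inj, of s \<tau>] t' \<tau> by auto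
        qed
        moreover have "\<gamma> t' \<in> \<gamma> ` {t'..b}" "0 \<in> \<gamma> ` {t'..b}"
          using t' \<gamma>(4) by force+
        \<comment> \<open>The arc must reach \<open>p\<close> along the arm \<open>e\<close> on
          which it started. The arm \<open>R\<close> and the arc up to \<open>\<tau>\<close> both
          contain \<open>w\<close> and \<open>p\<close>, so their intersection \<open>Y\<close> is
          connected and \<open>cmod (\<phi> z)\<close> takes on it all values between 0 and
          \<open>\<eta> / 2\<close>. A point of \<open>Y\<close> very close to \<open>p\<close> lies
          on the last piece of the arc before \<open>\<tau>\<close>, where the direction is
          \<open>- e1\<close>, and on \<open>R\<close>, where it is \<open>e\<close>.\<close>
        moreover have "e = - e1"
        proof -
          define s where "s = max a (\<tau> - d / 2)"
          have s: "a \<le> s" "\<tau> - d < s" "s < \<tau>" using \<tau> e1 by (auto simp: s_def)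
          have "p \<notin> \<gamma> ` {a..s}"
          proof
            assume "p \<in> \<gamma> ` {a..s}"
            then obtain q where "q \<in> {a..s}" "\<gamma> q = p" by auto
            then show False using inj_onD[OF inj, of q \<tau>] s \<tau> by auto
          qed
          moreover have "closed (\<gamma> ` {a..s})" using sub[of a s] s \<tau> compact_imp_closed by auto
          ultimately have op: "open (- \<gamma> ` {a..s})" "p \<in> - \<gamma> ` {a..s}" by auto
          have "\<psi> 0 = p" using \<phi>V[OF V(2)] \<phi>(2) by simp
          moreover have "isCont \<psi> 0" using cont\<psi> \<eta> by (simp add: continuous_on_eq_continuous_at)
          ultimately have "(\<psi> \<longlongrightarrow> p) (nhds 0)"
            by (simp add: tendsto_nhds_iff isCont_def)
          then have "\<forall>\<^sub>F v in nhds 0. \<psi> v \<in> - \<gamma> ` {a..s}"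
            using op by (rule topological_tendstoD)
          then obtain \<epsilon> where \<epsilon>: "\<epsilon> > 0" "\<And>v. cmod v < \<epsilon> \<Longrightarrow> \<psi> v \<in> - \<gamma> ` {a..s}"
            unfolding eventually_nhds_metric by auto
          define y where "y = min (\<epsilon> / 2) (\<eta> / 2)"
          have y: "0 < y" "y < \<epsilon>" "y \<le> \<eta> / 2" "y < \<eta>" using \<epsilon> \<eta> by (auto simp: y_def)
          define R where "R = \<psi> ` seg e (\<eta> / 2)"
          have h2: "0 < \<eta> / 2" "\<eta> / 2 < \<eta>" using \<eta> by auto
          have R: "compact R" "connected R" "R \<subseteq> Z"
            unfolding R_def using seg_ball[OF e h2] seg_Z[OF e h2] segs cont\<psi>
            by (auto intro!: compact_continuous_image connected_continuous_image intro: continuous_on_subset)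
          define Y where "Y = R \<inter> \<gamma> ` {a..\<tau>}"
          have "connected Y" unfolding Y_def
            using sub[of a \<tau>] \<tau> R by (intro connected_Int) auto
          have RV: "z \<in> V \<and> (\<exists>v. 0 \<le> v \<and> \<phi> z = of_real v * e)" if "z \<in> R" for z
          proof -
            obtain u where u: "u \<in> seg e (\<eta> / 2)" "z = \<psi> u" using \<open>z \<in> R\<close> R_def by blast
            then have "z \<in> V" "\<phi> z = u" using \<psi>B seg_ball[OF e h2] by blast+
            then show ?thesis using seg_elem[OF u(1) h2(1)] by blast
          qed
          have "continuous_on Y (\<lambda>z. cmod (\<phi> z))"
            using RV by (intro continuous_on_norm continuous_on_subset[OF holomorphic_on_imp_continuous_on[OF \<phi>(1)]])
              (auto simp: Y_def)
          then have con: "connected ((\<lambda>z. cmod (\<phi> z)) ` Y)"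
            using \<open>connected Y\<close> connected_continuous_image by blast
          have "p \<in> R" using \<open>\<psi> 0 = p\<close> segs(3) unfolding R_def by force
          moreover have "w \<in> R" unfolding R_def w_def using segs(4) by blast
          moreover have "p \<in> \<gamma> ` {a..\<tau>}" "w \<in> \<gamma> ` {a..\<tau>}" using \<tau> \<gamma>(3) by force+
          ultimately have "p \<in> Y" "w \<in> Y" by (auto simp: Y_def)
          moreover have "cmod (\<phi> p) = 0" "cmod (\<phi> w) = \<eta> / 2"
            unfolding \<phi>w(1) using \<phi>(2) e \<eta> by (auto simp: E_def norm_mult norm_divide)
          ultimately have "0 \<in> (\<lambda>z. cmod (\<phi> z)) ` Y" "\<eta> / 2 \<in> (\<lambda>z. cmod (\<phi> z)) ` Y"
            by (metis (no_types, lifting) image_eqI)+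
          then have "{0..\<eta> / 2} \<subseteq> (\<lambda>z. cmod (\<phi> z)) ` Y"
            by (rule connected_contains_Icc[OF con])
          moreover have "y \<in> {0..\<eta> / 2}" using y by simp
          ultimately have "y \<in> (\<lambda>z. cmod (\<phi> z)) ` Y" by blast
          then obtain z where z: "z \<in> Y" "cmod (\<phi> z) = y" by blast
          then obtain v where v: "0 \<le> v" "\<phi> z = of_real v * e" "z \<in> V"
            using RV unfolding Y_def by blast
          then have "v = y" using z(2) e by (simp add: norm_mult E_def)
          have "z = \<psi> (\<phi> z)" using \<phi>V v(3) by simp
          then have "z \<in> - \<gamma> ` {a..s}" using \<epsilon>(2)[of "\<phi> z"] z(2) y by auto
          moreover obtain t where t: "t \<in> {a..\<tau>}" "z = \<gamma> t" using z(1) by (auto simp: Y_def)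
          ultimately have "s < t" by auto
          moreover have "t \<noteq> \<tau>" using t \<tau>(3) z(2) \<phi>(2) y(1) by auto
          ultimately have "sgn (\<phi> z) = - e1" using before[of t] t s by auto
          moreover have "sgn (\<phi> z) = e" using v(2) \<open>v = y\<close> y sgnE[OF e] by simp
          ultimately show "e = - e1" by simp
        qed
        moreover have "compact (\<gamma> ` {t'..b})" "connected (\<gamma> ` {t'..b})" "\<gamma> ` {t'..b} \<subseteq> Z"
          using sub[of t' b] t' \<tau> by auto
        ultimately show ?thesis
          using x by (intro bexI[OF _ e1(1)] conjI disjI2 exI[of _ "\<gamma> ` {t'..b}"] exI[of _ x]) auto
      qed
    qed
  qed
  obtain e0 where "e0 \<in> E" using cardE by fastforce
  then obtain e0' T0 x0 where e0': "e0' \<in> E" and T0: "compact T0" "connected T0" "T0 \<subseteq> Z" "p \<notin> T0" "0 \<in> T0"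
      "0 < x0" "x0 < \<eta>" "\<psi> (of_real x0 * e0') \<in> T0"
    using access[of e0] by blast
  \<comment> \<open>Two continua that both contain 0 have a connected union, so \<open>key1\<close>
    identifies the arms that they reach.\<close>
  have "E \<subseteq> {e0', - e0'}"
  proof
    fix e assume "e \<in> E"
    then obtain e' T x where e': "e' \<in> E" "e = e' \<or> e = - e'" and T: "compact T" "connected T" "T \<subseteq> Z" "p \<notin> T" "0 \<in> T"
      "0 < x" "x < \<eta>" "\<psi> (of_real x * e') \<in> T"
      using access[of e] by blast
    have "e0' = e'"
      by (rule key1[of _ _ x0 x "T0 \<union> T"]) (use e0' e' T0 T in \<open>auto intro!: connected_Un compact_Un\<close>)
    then show "e \<in> {e0', - e0'}" using e' by auto
  qed
  then have "card E \<le> card {e0', - e0'}" by (intro card_mono) auto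
  also have "\<dots> \<le> 2" by (simp add: card_insert_if)
  finally show False using cardE by simp
qed

end

subsection \<open>Consequences of Schottky's theorem\<close>

text \<open>The bound of Schottky's theorem for a function with value of modulus at most 1 at the
  centre, at half the radius.\<close>

definition schottky_const :: real where
  "schottky_const = exp (pi * exp (16 * pi))"

text \<open>The map \<open>E\<close> unrolls the annulus: it sends the closed unit disk into it
  because 2 pi < 7, and the segment of imaginary numbers of modulus at most 1/2 onto the whole
  circle through \<open>z0\<close>. Schottky's theorem for \<open>g \<circ> E\<close> at half radius
  therefore controls \<open>g\<close> on that circle.\<close>

lemma Schottky_circle:
  assumes hol: "g holomorphic_on {z. cmod z0 * exp (-7) < cmod z \<and> cmod z < cmod z0 * exp 7}"
    and omit: "\<And>z. cmod z0 * exp (-7) < cmod z \<Longrightarrow> cmod z < cmod z0 * exp 7 \<Longrightarrow> g z \<noteq> 0 \<and> g z \<noteq> 1"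
    and "z0 \<noteq> 0" "cmod (g z0) \<le> 1" "cmod z = cmod z0"
  shows "cmod (g z) \<le> schottky_const"
proof -
  define E where "E = (\<lambda>\<zeta>. z0 * exp (2 * of_real pi * \<zeta>))"
  have ann: "cmod z0 * exp (-7) < cmod (E \<zeta>) \<and> cmod (E \<zeta>) < cmod z0 * exp 7" if "\<zeta> \<in> cball 0 1" for \<zeta>
  proof -
    have pi72: "pi < 7 / 2" using pi_approx by simp
    have "\<bar>Re \<zeta>\<bar> \<le> 1" using that abs_Re_le_cmod[of \<zeta>] by simp
    then have "\<bar>2 * pi * Re \<zeta>\<bar> \<le> 2 * pi"
      by (simp add: abs_mult mult_left_le)
    then have "\<bar>2 * pi * Re \<zeta>\<bar> < 7"
      using pi72 by linarith
    then have "- 7 < 2 * pi * Re \<zeta> \<and> 2 * pi * Re \<zeta> < 7" by linarith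
    then show ?thesis
      using \<open>z0 \<noteq> 0\<close> by (simp add: E_def norm_mult)
  qed
  define \<theta> where "\<theta> = Arg (z / z0)"
  have "z / z0 = exp (\<i> * of_real \<theta>)"
    using Arg_eq[of "z / z0"] assms by (fastforce simp: \<theta>_def norm_divide)
  then have z: "z = E (\<i> * of_real \<theta> / (2 * of_real pi))"
    using \<open>z0 \<noteq> 0\<close> by (simp add: E_def field_simps)
  have "\<bar>\<theta>\<bar> \<le> pi"
    using Arg_bounded[of "z / z0"] by (auto simp: \<theta>_def)
  then have le: "cmod (\<i> * of_real \<theta> / (2 * of_real pi)) \<le> 1 / 2"
    by (simp add: norm_mult norm_divide field_simps)
  have "cmod ((g \<circ> E) (\<i> * of_real \<theta> / (2 * of_real pi)))
      \<le> exp (pi * exp (pi * (2 + 2 * 1 + 12 * (1/2) / (1 - 1/2))))"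
  proof (rule Schottky[OF _ _ _ _ _ le])
    show "g \<circ> E holomorphic_on cball 0 1"
      by (rule holomorphic_on_compose_gen[OF _ hol]) (use ann in \<open>auto simp: E_def intro!: holomorphic_intros\<close>)
    show "cmod ((g \<circ> E) 0) \<le> 1" using assms by (simp add: E_def)
  qed (use ann omit in auto)
  then show ?thesis
    by (simp add: z schottky_const_def mult.commute)
qed

text \<open>Normality from omitted values: below the middle point \<open>F / a\<close> omits 0 and 1, above it
  \<open>a / F\<close> does, and both are at most 1 in modulus at some point of the respective circle.\<close>

lemma three_circles_bound:
  fixes F :: "complex \<Rightarrow> complex"
  assumes r: "0 < r" and hol: "F holomorphic_on ball 0 r" and F0: "F 0 = 0"
    and nz: "\<And>z. z \<in> ball 0 r \<Longrightarrow> F z = 0 \<Longrightarrow> z = 0" and d0: "deriv F 0 \<noteq> 0"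
    and z: "cmod z1 = r * exp (-21)" "cmod z2 = r * exp (-14)" "cmod z3 = r * exp (-7)"
    and le: "cmod (F z1) \<le> cmod (F z2)" "cmod (F z2) \<le> cmod (F z3)"
    and uniq: "\<And>z. z \<in> ball 0 r \<Longrightarrow> F z = F z2 \<Longrightarrow> z = z2"
    and w: "w \<in> cball 0 (r * exp (-21))"
  shows "cmod (F w) \<le> schottky_const\<^sup>2 * r * cmod (deriv F 0)"
proof -
  define a where "a = F z2"
  define M where "M = schottky_const"
  have Mpos: "M > 0" by (simp add: M_def schottky_const_def)
  have "cmod z3 < r" "cmod z2 < r" "cmod z1 < r" using r z by auto
  have znz: "z1 \<noteq> 0" "z2 \<noteq> 0" "z3 \<noteq> 0" using z r by auto
  have "a \<noteq> 0" unfolding a_def using nz[of z2] znz \<open>cmod z2 < r\<close> by auto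
  have F3: "F z3 \<noteq> 0" using nz[of z3] znz \<open>cmod z3 < r\<close> by auto
  \<comment> \<open>The point \<open>z2\<close> lies on the inner boundary of the annulus around the
    circle of \<open>z3\<close>, so the value \<open>a\<close> is omitted there. The quotient
    \<open>a / F\<close> is used since \<open>le\<close> makes it, and not its inverse, at most 1 in
    modulus at \<open>z3\<close>.\<close>
  have lower: "cmod (a / F z) \<le> M" if "cmod z = r * exp (-7)" for z
    unfolding M_def
  proof (rule Schottky_circle[of "\<lambda>z. a / F z" z3])
    have e: "cmod z3 * exp 7 = r" "cmod z3 * exp (-7) = cmod z2"
      using z by (simp_all add: mult.assoc flip: exp_add)
    show "(\<lambda>z. a / F z) holomorphic_on {z. cmod z3 * exp (-7) < cmod z \<and> cmod z < cmod z3 * exp 7}"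
      unfolding e using nz by (intro holomorphic_intros holomorphic_on_subset[OF hol]) fastforce+
    show "a / F z \<noteq> 0 \<and> a / F z \<noteq> 1" if "cmod z3 * exp (-7) < cmod z" "cmod z < cmod z3 * exp 7" for z
    proof -
      have "F z \<noteq> 0" using that nz[of z] e by auto
      moreover have "F z \<noteq> a" using that uniq[of z] e unfolding a_def by auto
      ultimately show ?thesis using \<open>a \<noteq> 0\<close> by auto
    qed
    show "cmod (a / F z3) \<le> 1"
      using le F3 by (simp add: norm_divide a_def)
  qed (use znz that z in auto)
  \<comment> \<open>Here \<open>z2\<close> lies on the outer boundary of the annulus.\<close>
  have upper: "cmod (F z / a) \<le> M" if "cmod z = r * exp (-21)" for z
    unfolding M_def
  proof (rule Schottky_circle[of "\<lambda>z. F z / a" z1])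
    have e: "cmod z1 * exp 7 = cmod z2"
      using z by (simp_all add: mult.assoc flip: exp_add)
    show "(\<lambda>z. F z / a) holomorphic_on {z. cmod z1 * exp (-7) < cmod z \<and> cmod z < cmod z1 * exp 7}"
      unfolding e using \<open>a \<noteq> 0\<close> \<open>cmod z2 < r\<close>
      by (intro holomorphic_intros holomorphic_on_subset[OF hol]) auto
    show "F z / a \<noteq> 0 \<and> F z / a \<noteq> 1" if "cmod z1 * exp (-7) < cmod z" "cmod z < cmod z1 * exp 7" for z
    proof -
      have pos: "0 < cmod z" using that(1) by (smt (verit) exp_ge_zero mult_nonneg_nonneg norm_ge_zero)
      have "F z \<noteq> 0" using pos that nz[of z] e \<open>cmod z2 < r\<close> by auto
      moreover have "F z \<noteq> a" using that uniq[of z] e \<open>cmod z2 < r\<close> unfolding a_def by auto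
      ultimately show ?thesis using \<open>a \<noteq> 0\<close> by auto
    qed
    show "cmod (F z1 / a) \<le> 1"
      using le \<open>a \<noteq> 0\<close> by (simp add: norm_divide a_def)
  qed (use znz that z in auto)
  \<comment> \<open>The quotient \<open>Q\<close> of \<open>F z\<close> by \<open>z\<close> has no
    zeros and equals \<open>F' 0\<close> at 0, so the maximum principle for \<open>1 / Q\<close>
    carries the estimate \<open>lower\<close> from the circle to the centre.\<close>
  have a_le: "cmod a \<le> r * M * cmod (deriv F 0)"
  proof -
    define R where "R = r * exp (-7)"
    have R: "0 < R" "R < r" using r by (auto simp: R_def)
    define Q where "Q = (\<lambda>z. if z = 0 then deriv F 0 else (F z - F 0) / (z - 0))"
    have holQ: "Q holomorphic_on ball 0 r"
      unfolding Q_def by (rule pole_lemma_open[OF hol]) auto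
    have Qnz: "Q z \<noteq> 0" if "z \<in> ball 0 r" for z
      using that nz[of z] d0 by (auto simp: Q_def F0)
    have holI: "(\<lambda>z. 1 / Q z) holomorphic_on ball 0 r"
      using Qnz by (intro holomorphic_intros holQ) auto
    have "cmod (1 / Q 0) \<le> R * M / cmod a"
    proof (rule maximum_modulus_frontier[of "\<lambda>z. 1 / Q z" "ball 0 R"])
      show "(\<lambda>z. 1 / Q z) holomorphic_on interior (ball 0 R)"
        using R by (intro holomorphic_on_subset[OF holI]) auto
      show "continuous_on (closure (ball 0 R)) (\<lambda>z. 1 / Q z)"
        using R by (intro holomorphic_on_imp_continuous_on holomorphic_on_subset[OF holI]) auto
      show "cmod (1 / Q z) \<le> R * M / cmod a" if "z \<in> frontier (ball 0 R)" for z
      proof -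
        have zR: "cmod z = R" using that R by (simp add: sphere_def dist_norm)
        have "z \<noteq> 0" using zR R by auto
        then have "cmod (1 / Q z) = R * cmod (a / F z) / cmod a"
          using \<open>a \<noteq> 0\<close> zR by (simp add: Q_def F0 norm_divide)
        also have "\<dots> \<le> R * M / cmod a"
          using lower[of z] zR R by (intro divide_right_mono mult_left_mono) (auto simp: R_def)
        finally show ?thesis .
      qed
    qed (use R in auto)
    then have "cmod a \<le> R * M * cmod (deriv F 0)"
      using d0 \<open>a \<noteq> 0\<close> by (simp add: Q_def norm_divide field_simps)
    also have "\<dots> \<le> r * M * cmod (deriv F 0)"
      using R Mpos by (intro mult_right_mono) auto
    finally show ?thesis .
  qed
  define R where "R = r * exp (-21)"
  have R: "0 < R" "R < r" using r by (auto simp: R_def)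
  have "cmod (F w) \<le> M * cmod a"
  proof (rule maximum_modulus_frontier[of F "cball 0 R"])
    show "F holomorphic_on interior (cball 0 R)"
      using R by (intro holomorphic_on_subset[OF hol]) auto
    show "continuous_on (closure (cball 0 R)) F"
      using R by (intro holomorphic_on_imp_continuous_on holomorphic_on_subset[OF hol]) auto
    show "cmod (F z) \<le> M * cmod a" if "z \<in> frontier (cball 0 R)" for z
      using upper[of z] that R \<open>a \<noteq> 0\<close> by (simp add: R_def norm_divide field_simps sphere_def dist_norm)
  qed (use w R_def in auto)
  also have "\<dots> \<le> M * (r * M * cmod (deriv F 0))"
    using a_le Mpos by (intro mult_left_mono) auto
  finally show ?thesis
    by (simp add: M_def power2_eq_square algebra_simps)
qed

text \<open>Cauchy's inequality on circles of radius \<open>R / 2\<close> bounds \<open>F''\<close>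
  by \<open>K * cmod (deriv F 0)\<close>; the 8 in \<open>K\<close> is 2! divided by the square of
  1/2. Within distance \<open>1 / (2 * K)\<close> of 0 the derivative \<open>F'\<close> then changes
  by at most half of its size at 0.\<close>

lemma deriv2_over_deriv_bound:
  fixes F :: "complex \<Rightarrow> complex"
  assumes R: "0 < R" and hol: "F holomorphic_on ball 0 R'" "R < R'"
    and bd: "\<And>z. z \<in> cball 0 R \<Longrightarrow> cmod (F z) \<le> B * cmod (deriv F 0)"
    and K: "K = 8 * B / R\<^sup>2" "K > 0"
    and d0: "deriv F 0 \<noteq> 0"
    and z: "cmod z \<le> R / 2" "cmod z \<le> 1 / (2 * K)"
  shows "deriv F z \<noteq> 0" "cmod (deriv (deriv F) z / deriv F z) \<le> 2 * K"
proof -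
  define D where "D = cmod (deriv F 0)"
  have Dpos: "D > 0" using d0 by (simp add: D_def)
  have d2: "cmod (deriv (deriv F) w) \<le> K * D" if "cmod w \<le> R / 2" for w
  proof -
    have sub: "cball w (R / 2) \<subseteq> cball 0 R"
      using that by (simp add: cball_subset_cball_iff dist_norm)
    then have sub': "cball w (R / 2) \<subseteq> ball 0 R'" "ball w (R / 2) \<subseteq> ball 0 R'"
      using hol(2) ball_subset_cball[of w "R / 2"] by fastforce+
    have "cmod ((deriv ^^ 2) F w) \<le> fact 2 * (B * D) / (R / 2)^2"
    proof (rule Cauchy_inequality)
      show "F holomorphic_on ball w (R / 2)"
        by (rule holomorphic_on_subset[OF hol(1) sub'(2)])
      show "continuous_on (cball w (R / 2)) F"
        by (rule holomorphic_on_imp_continuous_on[OF holomorphic_on_subset[OF hol(1) sub'(1)]])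
      show "cmod (F x) \<le> B * D" if "cmod (w - x) = R / 2" for x
      proof -
        have "x \<in> cball w (R / 2)" using that by (simp add: dist_norm)
        then show ?thesis using bd sub unfolding D_def by blast
      qed
    qed (use R in auto)
    also have "\<dots> = K * D"
      using R by (simp add: K field_simps power2_eq_square)
    finally show ?thesis by (simp add: numeral_2_eq_2)
  qed
  have "cmod (deriv F z - deriv F 0) \<le> K * D * cmod (z - 0)"
  proof (rule field_differentiable_bound[of "cball 0 (R / 2)" "deriv F" "deriv (deriv F)"])
    fix w :: complex assume w: "w \<in> cball 0 (R / 2)"
    then have "w \<in> ball 0 R'" using R hol(2) by auto
    then show "(deriv F has_field_derivative deriv (deriv F) w) (at w within cball 0 (R / 2))"
      using holomorphic_derivI[OF holomorphic_deriv[OF hol(1) open_ball] open_ball]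
      by (auto intro: has_field_derivative_at_within)
    show "cmod (deriv (deriv F) w) \<le> K * D" using d2 w by auto
  qed (use z R in auto)
  also have "\<dots> \<le> K * D * (1 / (2 * K))"
    using z K(2) Dpos by (intro mult_left_mono) auto
  also have "\<dots> = D / 2" using K(2) by simp
  finally have half: "D / 2 \<le> cmod (deriv F z)"
    using norm_triangle_ineq2[of "deriv F 0" "deriv F z"]
    by (simp add: D_def norm_minus_commute)
  then show nz: "deriv F z \<noteq> 0" using Dpos by auto
  have "cmod (deriv (deriv F) z) \<le> K * D" using d2 z by simp
  also have "\<dots> \<le> 2 * K * cmod (deriv F z)"
    using mult_left_mono[OF half, of "2 * K"] K by simp
  finally show "cmod (deriv (deriv F) z / deriv F z) \<le> 2 * K"
    using nz by (simp add: norm_divide field_simps)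
qed

subsection \<open>Harmonic functions as real parts\<close>

lemma has_derivative_Re_Im_line:
  assumes "(g has_derivative (\<lambda>h. a * Re h + b * Im h)) (at (Complex x y))"
  shows "((\<lambda>s. g (Complex s y)) has_real_derivative a) (at x)"
    and "((\<lambda>s. g (Complex x s)) has_real_derivative b) (at y)"
proof -
  have "((\<lambda>s. Complex s y) has_derivative (\<lambda>h. of_real h)) (at x)"
    unfolding Complex_eq by (auto intro!: derivative_eq_intros)
  from has_derivative_compose[OF this assms]
  show "((\<lambda>s. g (Complex s y)) has_real_derivative a) (at x)"
    by (simp add: has_field_derivative_def mult_commute_abs)
  have "((\<lambda>s. Complex x s) has_derivative (\<lambda>h. \<i> * of_real h)) (at y)"
    unfolding Complex_eq by (auto intro!: derivative_eq_intros)
  from has_derivative_compose[OF this assms]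
  show "((\<lambda>s. g (Complex x s)) has_real_derivative b) (at y)"
    by (simp add: has_field_derivative_def mult_commute_abs)
qed

text \<open>Both mixed derivatives are limits of the same second difference.\<close>

lemma mixed_partials_eq:
  fixes u :: "complex \<Rightarrow> real"
  assumes "open S" "z \<in> S"
    and u: "\<And>z. z \<in> S \<Longrightarrow> (u has_derivative (\<lambda>h. ux z * Re h + uy z * Im h)) (at z)"
    and ux: "\<And>z. z \<in> S \<Longrightarrow> (ux has_derivative (\<lambda>h. uxx z * Re h + uxy z * Im h)) (at z)"
    and uy: "\<And>z. z \<in> S \<Longrightarrow> (uy has_derivative (\<lambda>h. uyx z * Re h + uyy z * Im h)) (at z)"
    and cont: "continuous_on S uxy" "continuous_on S uyx"
  shows "uxy z = uyx z"
proof (rule ccontr)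
  assume ne: "uxy z \<noteq> uyx z"
  define e where "e = \<bar>uxy z - uyx z\<bar> / 2"
  have e: "e > 0" using ne by (simp add: e_def)
  obtain d0 where d0: "d0 > 0" "ball z d0 \<subseteq> S"
    using assms(1,2) openE by blast
  obtain d1 where d1: "d1 > 0" "\<And>w. w \<in> S \<Longrightarrow> dist w z < d1 \<Longrightarrow> dist (uxy w) (uxy z) < e"
    using cont(1) assms(2) e unfolding continuous_on_iff by blast
  obtain d2 where d2: "d2 > 0" "\<And>w. w \<in> S \<Longrightarrow> dist w z < d2 \<Longrightarrow> dist (uyx w) (uyx z) < e"
    using cont(2) assms(2) e unfolding continuous_on_iff by blast
  define m where "m = min d0 (min d1 d2)"
  \<comment> \<open>All points of the square of side \<open>h\<close> with corner \<open>z\<close>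
    are within \<open>2 * h < m\<close> of \<open>z\<close>.\<close>
  define h where "h = m / 4"
  have m: "m > 0" using d0 d1 d2 by (simp add: m_def)
  then have h: "h > 0" by (simp add: h_def)
  obtain x y where z: "z = Complex x y" by (cases z)
  have near: "dist (Complex s t) z < m" if "s \<in> {x..x+h}" "t \<in> {y..y+h}" for s t
  proof -
    have "dist (Complex s t) z = cmod (Complex (s - x) (t - y))"
      by (simp add: z dist_norm complex_diff)
    also have "\<dots> \<le> \<bar>s - x\<bar> + \<bar>t - y\<bar>"
      using cmod_le[of "Complex (s - x) (t - y)"] by simp
    also have "\<dots> \<le> 2 * h" using that by auto
    also have "\<dots> < m" using m by (simp add: h_def)
    finally show ?thesis .
  qed
  have inS: "Complex s t \<in> S" if "s \<in> {x..x+h}" "t \<in> {y..y+h}" for s t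
    using near[OF that] d0(2) by (auto simp: dist_commute m_def)
  define D where "D = u (Complex (x + h) (y + h)) - u (Complex (x + h) y) - (u (Complex x (y + h)) - u (Complex x y))"
  have "\<exists>s t. s \<in> {x..x+h} \<and> t \<in> {y..y+h} \<and> D = h * h * uxy (Complex s t)"
  proof -
    have "\<exists>s. x < s \<and> s < x + h \<and> (\<lambda>s. u (Complex s (y + h)) - u (Complex s y)) (x + h) - (\<lambda>s. u (Complex s (y + h)) - u (Complex s y)) x
        = (x + h - x) * (ux (Complex s (y + h)) - ux (Complex s y))"
      by (rule MVT2) (use h in \<open>auto intro!: derivative_intros has_derivative_Re_Im_line(1)[OF u] inS\<close>)
    then obtain s where s: "x < s" "s < x + h" "D = h * (ux (Complex s (y + h)) - ux (Complex s y))"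
      by (auto simp: D_def)
    have "\<exists>t. y < t \<and> t < y + h \<and> ux (Complex s (y + h)) - ux (Complex s y) = (y + h - y) * uxy (Complex s t)"
      by (rule MVT2) (use h s in \<open>auto intro!: has_derivative_Re_Im_line(2)[OF ux] inS\<close>)
    then obtain t where "y < t" "t < y + h" "ux (Complex s (y + h)) - ux (Complex s y) = h * uxy (Complex s t)"
      by auto
    then show ?thesis using s by (intro exI[of _ s] exI[of _ t]) auto
  qed
  then obtain s t where st: "s \<in> {x..x+h}" "t \<in> {y..y+h}" "D = h * h * uxy (Complex s t)" by blast
  have "\<exists>s t. s \<in> {x..x+h} \<and> t \<in> {y..y+h} \<and> D = h * h * uyx (Complex s t)"
  proof -
    have "\<exists>t. y < t \<and> t < y + h \<and> (\<lambda>t. u (Complex (x + h) t) - u (Complex x t)) (y + h) - (\<lambda>t. u (Complex (x + h) t) - u (Complex x t)) y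
        = (y + h - y) * (uy (Complex (x + h) t) - uy (Complex x t))"
      by (rule MVT2) (use h in \<open>auto intro!: derivative_intros has_derivative_Re_Im_line(2)[OF u] inS\<close>)
    then obtain t where t: "y < t" "t < y + h" "D = h * (uy (Complex (x + h) t) - uy (Complex x t))"
      by (auto simp: D_def algebra_simps)
    have "\<exists>s. x < s \<and> s < x + h \<and> uy (Complex (x + h) t) - uy (Complex x t) = (x + h - x) * uyx (Complex s t)"
      by (rule MVT2) (use h t in \<open>auto intro!: has_derivative_Re_Im_line(1)[OF uy] inS\<close>)
    then obtain s where "x < s" "s < x + h" "uy (Complex (x + h) t) - uy (Complex x t) = h * uyx (Complex s t)"
      by auto
    then show ?thesis using t by (intro exI[of _ s] exI[of _ t]) auto
  qed
  then obtain s' t' where st': "s' \<in> {x..x+h}" "t' \<in> {y..y+h}" "D = h * h * uyx (Complex s' t')" by blast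
  have "uxy (Complex s t) = uyx (Complex s' t')" using st(3) st'(3) h by simp
  moreover have "\<bar>uxy (Complex s t) - uxy z\<bar> < e"
    using d1(2)[OF inS[OF st(1,2)]] near[OF st(1,2)] by (simp add: dist_real_def m_def)
  moreover have "\<bar>uyx (Complex s' t') - uyx z\<bar> < e"
    using d2(2)[OF inS[OF st'(1,2)]] near[OF st'(1,2)] by (simp add: dist_real_def m_def)
  ultimately have "\<bar>uxy z - uyx z\<bar> < e + e" by arith
  then show False by (simp add: e_def)
qed

text \<open>The function \<open>ux - \<i> uy\<close> satisfies the Cauchy-Riemann equations: one is
  Laplace's equation, the other the symmetry of the mixed derivatives. A primitive of it on the
  convex disk has real part \<open>u\<close> up to a constant, which vanishes by normalising at
  \<open>c\<close>.\<close>

lemma harmonic_on_ball_imp_Re: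
  fixes u :: "complex \<Rightarrow> real"
  assumes "u harmonic_on ball c r" "0 < r" "u c = 0"
  obtains f where "f holomorphic_on ball c r" "\<And>z. z \<in> ball c r \<Longrightarrow> Re (f z) = u z" "f c = 0"
proof -
  let ?S = "ball c r"
  obtain ux uy uxx uxy uyx uyy where
      u: "\<And>z. z \<in> ?S \<Longrightarrow> (u has_derivative (\<lambda>h. ux z * Re h + uy z * Im h)) (at z)"
    and ux: "\<And>z. z \<in> ?S \<Longrightarrow> (ux has_derivative (\<lambda>h. uxx z * Re h + uxy z * Im h)) (at z)"
    and uy: "\<And>z. z \<in> ?S \<Longrightarrow> (uy has_derivative (\<lambda>h. uyx z * Re h + uyy z * Im h)) (at z)"
    and lap: "\<And>z. z \<in> ?S \<Longrightarrow> uxx z + uyy z = 0"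
    and cont: "continuous_on ?S uxy" "continuous_on ?S uyx"
    using assms(1) unfolding harmonic_on_def by blast
  have sym: "uxy z = uyx z" if "z \<in> ?S" for z
    by (rule mixed_partials_eq[OF open_ball that u ux uy cont])
  define g where "g = (\<lambda>z. of_real (ux z) - \<i> * of_real (uy z))"
  have "(g has_field_derivative (of_real (uxx z) - \<i> * of_real (uyx z))) (at z)" if z: "z \<in> ?S" for z
  proof -
    have "(g has_derivative (\<lambda>h. of_real (uxx z * Re h + uxy z * Im h) - \<i> * of_real (uyx z * Re h + uyy z * Im h))) (at z)"
      unfolding g_def using ux[OF z] uy[OF z] by (auto intro!: derivative_eq_intros)
    moreover have "of_real (uxx z * Re h + uxy z * Im h) - \<i> * of_real (uyx z * Re h + uyy z * Im h)
        = (of_real (uxx z) - \<i> * of_real (uyx z)) * h" for h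
      using sym[OF z] lap[OF z] by (auto simp: complex_eq_iff algebra_simps add_eq_0_iff2)
    ultimately show ?thesis by (simp add: has_field_derivative_def)
  qed
  then have "g holomorphic_on ?S"
    unfolding holomorphic_on_open[OF open_ball] by blast
  then obtain G where G: "\<And>z. z \<in> ?S \<Longrightarrow> (G has_field_derivative g z) (at z within ?S)"
    using holomorphic_convex_primitive'[OF convex_ball open_ball] by blast
  then have G': "(G has_field_derivative g z) (at z)" if "z \<in> ?S" for z
    using that at_within_open[OF that open_ball] by metis
  define f where "f = (\<lambda>z. G z - G c)"
  have "Re (f z) - u z = Re (f c) - u c" if z: "z \<in> ?S" for z
  proof (rule has_derivative_zero_unique[of ?S "\<lambda>z. Re (f z) - u z"])
    fix w assume w: "w \<in> ?S"
    have "(f has_derivative (\<lambda>h. g w * h)) (at w)"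
      unfolding f_def using G'[OF w] by (auto simp: has_field_derivative_def intro!: derivative_eq_intros)
    then have "((\<lambda>z. Re (f z) - u z) has_derivative (\<lambda>h. Re (g w * h) - (ux w * Re h + uy w * Im h))) (at w)"
      using u[OF w] by (intro derivative_intros) auto
    moreover have "(\<lambda>h. Re (g w * h) - (ux w * Re h + uy w * Im h)) = (\<lambda>h. 0)"
      by (auto simp: g_def)
    ultimately show "((\<lambda>z. Re (f z) - u z) has_derivative (\<lambda>h. 0)) (at w within ?S)"
      by (simp add: has_derivative_at_withinI)
  qed (use assms(2) z in auto)
  then have "Re (f z) = u z" if "z \<in> ?S" for z
    using that assms(3) by (simp add: f_def)
  moreover have "f holomorphic_on ?S"
  proof -
    have "G holomorphic_on ?S"
      unfolding holomorphic_on_open[OF open_ball] using G' by blast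
    then show ?thesis unfolding f_def by (intro holomorphic_intros)
  qed
  ultimately show ?thesis using that by (simp add: f_def)
qed

subsection \<open>The root of \<open>f\<close> and the curvature\<close>

context star_shaped_nodal
begin

text \<open>Away from 0 neither \<open>\<gamma>'\<close> nor \<open>f'\<close> vanishes on the arc.
  As \<open>Re f\<close> is constant along it, the nonzero derivative of
  \<open>f \<circ> \<gamma>\<close> is purely imaginary.\<close>

lemma arc_Im_deriv:
  assumes arc: "regular_arc \<gamma> a b" "\<gamma> ` {a..b} \<subseteq> Z" "\<gamma> b = 0" and t: "a < t" "t < b"
  shows "\<exists>D. D \<noteq> 0 \<and> ((\<lambda>t. Im (f (\<gamma> t))) has_real_derivative D) (at t)"
proof -
  obtain c where c: "c \<noteq> 0" "(\<gamma> has_vector_derivative c) (at t)"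
    using arc(1) t unfolding regular_arc_def by (meson greaterThanLessThan_iff)
  have inj: "inj_on \<gamma> {a..b}" using arc(1) by (simp add: regular_arc_def)
  have "\<gamma> t \<noteq> 0" using inj_onD[OF inj, of t b] t arc(3) by auto
  moreover have tZ: "\<gamma> t \<in> Z" using arc(2) t by auto
  ultimately have nz: "c * deriv f (\<gamma> t) \<noteq> 0" using c deriv_nonzero by simp
  have "\<gamma> t \<in> ball 0 r" using tZ Z_ball by blast
  then have "(f has_field_derivative deriv f (\<gamma> t)) (at (\<gamma> t))"
    by (rule holomorphic_derivI[OF hol open_ball])
  from field_vector_diff_chain_at[OF c(2) this]
  have der: "((\<lambda>t. f (\<gamma> t)) has_vector_derivative c * deriv f (\<gamma> t)) (at t)"
    by (simp add: o_def)
  have "((\<lambda>t. Re (f (\<gamma> t))) has_real_derivative Re (c * deriv f (\<gamma> t))) (at t)"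
    using bounded_linear.has_vector_derivative[OF bounded_linear_Re der]
    by (simp only: has_real_derivative_iff_has_vector_derivative)
  moreover have "((\<lambda>t. Re (f (\<gamma> t))) has_real_derivative 0) (at t)"
  proof (rule has_field_derivative_transform_within_open[of "\<lambda>_. 0" _ _ "{a<..<b}"])
    show "0 = Re (f (\<gamma> s))" if "s \<in> {a<..<b}" for s
    proof -
      have "\<gamma> s \<in> Z" using that arc(2) by auto
      then show ?thesis by (simp add: Z_def)
    qed
  qed (use t in auto)
  ultimately have "Re (c * deriv f (\<gamma> t)) = 0" by (rule DERIV_unique)
  then have "Im (c * deriv f (\<gamma> t)) \<noteq> 0" using nz complex_eq_iff by auto
  moreover have "((\<lambda>t. Im (f (\<gamma> t))) has_real_derivative Im (c * deriv f (\<gamma> t))) (at t)"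
    using bounded_linear.has_vector_derivative[OF bounded_linear_Im der]
    by (simp only: has_real_derivative_iff_has_vector_derivative)
  ultimately show ?thesis by blast
qed

lemma arc_f_cont:
  assumes "regular_arc \<gamma> a b" "\<gamma> ` {a..b} \<subseteq> Z" "g holomorphic_on ball 0 r"
  shows "continuous_on {a..b} (\<lambda>t. g (\<gamma> t))"
  by (rule continuous_on_compose2[OF holomorphic_on_imp_continuous_on[OF assms(3)]])
     (use assms Z_ball in \<open>auto simp: regular_arc_def\<close>)

lemma arc_Im_inj:
  assumes arc: "regular_arc \<gamma> a b" "\<gamma> ` {a..b} \<subseteq> Z" "\<gamma> b = 0"
  shows "inj_on (\<lambda>t. Im (f (\<gamma> t))) {a..b}"
proof -
  have "False" if xy: "x \<in> {a..b}" "y \<in> {a..b}" "x < y" "Im (f (\<gamma> x)) = Im (f (\<gamma> y))" for x y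
  proof -
    have "\<exists>z. x < z \<and> z < y \<and> ((\<lambda>t. Im (f (\<gamma> t))) has_real_derivative 0) (at z)"
    proof (rule Rolle[OF xy(3,4)])
      show "continuous_on {x..y} (\<lambda>t. Im (f (\<gamma> t)))"
        using arc_f_cont[OF arc(1,2) hol] xy by (intro continuous_on_Im) (auto intro: continuous_on_subset)
      show "(\<lambda>t. Im (f (\<gamma> t))) differentiable (at t)" if "x < t" "t < y" for t
        using arc_Im_deriv[OF arc, of t] that xy by (auto simp: real_differentiable_def)
    qed
    then obtain z where "x < z" "z < y" "((\<lambda>t. Im (f (\<gamma> t))) has_real_derivative 0) (at z)" by blast
    then show False using arc_Im_deriv[OF arc, of z] xy DERIV_unique by fastforce
  qed
  then show ?thesis by (intro inj_onI) (metis linorder_neqE)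
qed

text \<open>A second zero would be joined to 0 by an arc along which \<open>Im f\<close>, injective
  by Rolle's theorem, has the same value at both ends.\<close>

lemma f_nonzero:
  assumes "p \<in> ball 0 r" "f p = 0"
  shows "p = 0"
proof (rule ccontr)
  assume "p \<noteq> 0"
  have "p \<in> Z" using assms by (simp add: Z_def)
  then obtain \<gamma> a b where arc: "regular_arc \<gamma> a b" "\<gamma> ` {a..b} \<subseteq> Z" "\<gamma> a = p" "\<gamma> b = 0"
    by (rule nodal_arc[OF _ \<open>p \<noteq> 0\<close>])
  then have "a < b" by (simp add: regular_arc_def)
  with inj_onD[OF arc_Im_inj[OF arc(1,2,4)], of a b] show False
    using arc(3,4) assms f_0 by auto
qed

text \<open>With 0 as its only zero, \<open>f\<close> divided by \<open>z ^ m\<close> extends to a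
  zero-free function on the disk and so has a logarithm \<open>L\<close>; the root is
  \<open>z * exp (L z / m)\<close>.\<close>

lemma root_exists:
  obtains m :: nat and F where "m > 0" "F holomorphic_on ball 0 r"
    "\<And>z. z \<in> ball 0 r \<Longrightarrow> f z = F z ^ m" "F 0 = 0" "deriv F 0 \<noteq> 0"
proof -
  have "0 \<in> ball (0::complex) r" using r_pos by simp
  obtain g \<rho> m where m: "0 < m" "0 < \<rho>" "ball (0::complex) \<rho> \<subseteq> ball 0 r" "g holomorphic_on ball 0 \<rho>"
      "\<And>w. w \<in> ball 0 \<rho> \<Longrightarrow> f w = (w - 0) ^ m * g w" "\<And>w. w \<in> ball 0 \<rho> \<Longrightarrow> g w \<noteq> 0"
  proof (rule holomorphic_factor_zero_nonconstant[OF hol open_ball connected_ball \<open>0 \<in> ball 0 r\<close> f_0 nonconst])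
  qed (rule that)
  define h where "h = (\<lambda>z. if z = 0 then g 0 else f z / z ^ m)"
  have "h holomorphic_on ball 0 \<rho>"
    using m(4) by (rule holomorphic_transform) (use m(5) in \<open>auto simp: h_def\<close>)
  moreover have "h holomorphic_on ball 0 r - {0}"
    by (rule holomorphic_transform[of "\<lambda>z. f z / z ^ m"])
       (auto simp: h_def intro!: holomorphic_intros holomorphic_on_subset[OF hol])
  ultimately have "h holomorphic_on ball 0 \<rho> \<union> (ball 0 r - {0})"
    by (intro holomorphic_on_Un) (auto intro: open_Diff)
  moreover have "ball 0 \<rho> \<union> (ball 0 r - {0}) = ball (0::complex) r" using m(2,3) by auto
  ultimately have holh: "h holomorphic_on ball 0 r" by simp
  have hnz: "h z \<noteq> 0" if "z \<in> ball 0 r" for z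
    using that f_nonzero[of z] m(2) m(6)[of 0] by (auto simp: h_def)
  obtain L where L: "L holomorphic_on ball 0 r" "\<And>z. z \<in> ball 0 r \<Longrightarrow> h z = exp (L z)"
  proof (rule contractible_imp_holomorphic_log[OF holh convex_imp_contractible[OF convex_ball]])
    show "h z \<noteq> 0" if "z \<in> ball 0 r" for z using hnz that .
  qed (rule that)
  define F where "F = (\<lambda>z. z * exp (L z / of_nat m))"
  show ?thesis
  proof
    show "m > 0" by fact
    show "F holomorphic_on ball 0 r" unfolding F_def using m(1) by (intro holomorphic_intros L(1)) auto
    show "f z = F z ^ m" if z: "z \<in> ball 0 r" for z
    proof -
      have "F z ^ m = z ^ m * h z"
        using L(2)[OF z] m(1) by (simp add: F_def power_mult_distrib flip: exp_of_nat_mult)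
      also have "\<dots> = f z" using m(1) f_0 by (auto simp: h_def)
      finally show ?thesis by simp
    qed
    show "F 0 = 0" by (simp add: F_def)
    have "(L has_field_derivative deriv L 0) (at 0)"
      using r_pos by (intro holomorphic_derivI[OF L(1)]) auto
    then have "(F has_field_derivative exp (L 0 / of_nat m)) (at 0)"
      unfolding F_def using m(1) by (auto intro!: derivative_eq_intros)
    then show "deriv F 0 \<noteq> 0" using DERIV_imp_deriv by fastforce
  qed
qed

end

section \<open>Preimages under \<open>F\<close> of the rays on which
  \<open>Re (w ^ m) = 0\<close>\<close>

locale nodal_root = star_shaped_nodal +
  fixes F :: "complex \<Rightarrow> complex" and m :: nat
  assumes m_pos: "m > 0" and holF: "F holomorphic_on ball 0 r"
    and f_eq: "\<And>z. z \<in> ball 0 r \<Longrightarrow> f z = F z ^ m"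
    and F_0: "F 0 = 0" and dF_0: "deriv F 0 \<noteq> 0"
begin

lemma F_nonzero: "z \<in> ball 0 r \<Longrightarrow> F z = 0 \<Longrightarrow> z = 0"
  using f_nonzero f_eq m_pos by simp

text \<open>Away from 0 a critical point of \<open>F\<close> is one of \<open>f\<close>. In contrast
  to \<open>f\<close>, the root is regular at 0 as well, so it is locally injective at every point
  of \<open>Z\<close>.\<close>

lemma deriv_F_nonzero:
  assumes "z \<in> Z"
  shows "deriv F z \<noteq> 0"
proof (cases "z = 0")
  case False
  have z: "z \<in> ball 0 r" using assms Z_ball by blast
  have "(F has_field_derivative deriv F z) (at z)"
    by (rule holomorphic_derivI[OF holF open_ball z])
  then have "((\<lambda>z. F z ^ m) has_field_derivative of_nat m * (deriv F z * F z ^ (m - 1))) (at z)"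
    by (auto intro!: derivative_eq_intros)
  then have "(f has_field_derivative of_nat m * (deriv F z * F z ^ (m - 1))) (at z)"
    by (rule has_field_derivative_transform_within_open[OF _ open_ball z]) (simp add: f_eq)
  then have "deriv f z = of_nat m * (deriv F z * F z ^ (m - 1))" by (rule DERIV_imp_deriv)
  then show ?thesis using deriv_nonzero[OF assms False] by auto
qed (use dF_0 in auto)

lemma ray_in_Z:
  assumes "Re (e ^ m) = 0" "z \<in> ball 0 r" "F z = of_real s * e"
  shows "z \<in> Z"
proof -
  have Re_of_real_mult: "Re (of_real a * z) = a * Re z" for a z by simp
  have "f z = of_real (s ^ m) * e ^ m" using assms f_eq by (simp add: power_mult_distrib)
  then have "Re (f z) = s ^ m * Re (e ^ m)" by (simp only: Re_of_real_mult)
  then show ?thesis using assms by (simp add: Z_def)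
qed

text \<open>Along the nodal arc from \<open>z\<close> to 0 the direction of \<open>F\<close> is
  constant and its modulus injective, so \<open>F\<close> maps the arc bijectively onto the segment
  from \<open>of_real s * e\<close> to 0. The lift is the arc reparametrised by the modulus of
  \<open>F\<close>.\<close>

lemma ray_lift:
  assumes e: "cmod e = 1" "Re (e ^ m) = 0" and z: "z \<in> ball 0 r" "F z = of_real s * e" and s: "s > 0"
  obtains \<alpha> where "continuous_on {0..s} \<alpha>" "\<alpha> ` {0..s} \<subseteq> Z" "\<alpha> s = z"
    "\<And>x. x \<in> {0..s} \<Longrightarrow> F (\<alpha> x) = of_real x * e"
proof -
  have zZ: "z \<in> Z" by (rule ray_in_Z[OF e(2) z])
  have "z \<noteq> 0" using z F_0 e s by auto
  obtain \<gamma> a b where arc: "regular_arc \<gamma> a b" "\<gamma> ` {a..b} \<subseteq> Z" "\<gamma> a = z" "\<gamma> b = 0"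
    by (rule nodal_arc[OF zZ \<open>z \<noteq> 0\<close>])
  have ab: "a < b" and cont\<gamma>: "continuous_on {a..b} \<gamma>" and inj\<gamma>: "inj_on \<gamma> {a..b}"
    using arc(1) by (auto simp: regular_arc_def)
  have \<gamma>ball: "\<gamma> t \<in> ball 0 r" if "t \<in> {a..b}" for t using that arc(2) Z_ball by blast
  define v where "v = (\<lambda>t. Im (f (\<gamma> t)))"
  have contv: "continuous_on {a..b} v"
    unfolding v_def by (intro continuous_on_Im arc_f_cont arc hol)
  have injv: "inj_on v {a..b}"
    unfolding v_def by (rule arc_Im_inj[OF arc(1,2,4)])
  have vb: "v b = 0" using arc(4) f_0 by (simp add: v_def)
  have "strict_mono_on {a..b} v \<or> strict_antimono_on {a..b} v"
    using injective_eq_monotone_map[of "{a..b}" v] contv injv by (auto simp: is_interval_cc)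
  \<comment> \<open>Being monotone with value 0 at the end \<open>b\<close>, \<open>v\<close> keeps
    one sign, so its absolute value is injective too, and hence \<open>N\<close>.\<close>
  then have sgnv: "(\<forall>t\<in>{a..b}. v t \<le> 0) \<or> (\<forall>t\<in>{a..b}. 0 \<le> v t)"
  proof
    assume "strict_mono_on {a..b} v"
    then have "v t \<le> v b" if "t \<in> {a..b}" for t
      using that ab by (cases "t = b") (auto simp: monotone_on_def less_imp_le)
    then show ?thesis using vb by simp
  next
    assume "strict_antimono_on {a..b} v"
    then have "v b \<le> v t" if "t \<in> {a..b}" for t
      using that ab by (cases "t = b") (auto simp: monotone_on_def less_imp_le)
    then show ?thesis using vb by simp
  qed
  define N where "N = (\<lambda>t. cmod (F (\<gamma> t)))"
  have N_pow: "N t ^ m = \<bar>v t\<bar>" if "t \<in> {a..b}" for t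
  proof -
    have "\<gamma> t \<in> Z" using that arc(2) by blast
    then have "Re (f (\<gamma> t)) = 0" by (simp add: Z_def)
    then have "cmod (f (\<gamma> t)) = \<bar>v t\<bar>" by (simp add: cmod_eq_Im v_def)
    then show ?thesis using f_eq[OF \<gamma>ball[OF that]] by (simp add: N_def norm_power)
  qed
  have injN: "inj_on N {a..b}"
  proof (rule inj_onI)
    fix x y assume xy: "x \<in> {a..b}" "y \<in> {a..b}" "N x = N y"
    then have "\<bar>v x\<bar> = \<bar>v y\<bar>" using N_pow by metis
    moreover have "(v x \<le> 0 \<and> v y \<le> 0) \<or> (0 \<le> v x \<and> 0 \<le> v y)"
      using sgnv xy(1,2) by blast
    ultimately have "v x = v y" by linarith
    then show "x = y" using injv xy by (auto dest: inj_onD)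
  qed
  have contF: "continuous_on {a..b} (\<lambda>t. F (\<gamma> t))"
    by (rule arc_f_cont[OF arc(1,2) holF])
  have contN: "continuous_on {a..b} N"
    unfolding N_def by (intro continuous_on_norm contF)
  have Na: "N a = s" and Nb: "N b = 0" using arc z s e F_0 by (auto simp: N_def norm_mult)
  have Fnz: "F (\<gamma> t) \<noteq> 0" if "t \<in> {a..<b}" for t
  proof
    assume "F (\<gamma> t) = 0"
    then have "\<gamma> t = \<gamma> b" using that F_nonzero[OF \<gamma>ball[of t]] arc(4) by auto
    then show False using inj_onD[OF inj\<gamma>, of t b] that ab by auto
  qed
  \<comment> \<open>The direction \<open>sgn (F (\<gamma> t))\<close> is continuous before
    \<open>b\<close> with values in a finite set, hence equal to its value \<open>e\<close> at
    \<open>a\<close>.\<close>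
  have dir: "F (\<gamma> t) = of_real (N t) * e" if t: "t \<in> {a..b}" for t
  proof (cases "t = b")
    case False
    let ?g = "\<lambda>t. sgn (F (\<gamma> t))"
    have "continuous_on {a..<b} ?g"
      using Fnz by (intro continuous_on_sgn continuous_on_subset[OF contF]) auto
    then have con: "connected (?g ` {a..<b})"
      by (intro connected_continuous_image) (auto simp: is_interval_connected_1[symmetric] is_interval_1)
    have "?g u \<in> {e. cmod e = 1 \<and> Re (e ^ m) = 0}" if u: "u \<in> {a..<b}" for u
    proof -
      have "\<gamma> u \<in> Z" using u arc(2) by auto
      then have "Re (f (\<gamma> u)) = 0" by (simp add: Z_def)
      then have "Re (F (\<gamma> u) ^ m) = 0" using f_eq[OF \<gamma>ball[of u]] u by auto
      moreover have "sgn (F (\<gamma> u)) ^ m = F (\<gamma> u) ^ m / of_real (cmod (F (\<gamma> u)) ^ m)"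
        by (simp add: sgn_eq power_divide)
      ultimately have "Re (sgn (F (\<gamma> u)) ^ m) = 0"
        by (simp only: Re_divide_of_real)
      then show ?thesis using Fnz[OF u] by (simp add: norm_sgn)
    qed
    then have "?g ` {a..<b} \<subseteq> {e. cmod e = 1 \<and> Re (e ^ m) = 0}" by blast
    then have "finite (?g ` {a..<b})"
      using finite_unit_imaginary_roots[OF m_pos] finite_subset by blast
    moreover have "?g t \<in> ?g ` {a..<b}" "?g a \<in> ?g ` {a..<b}" using t False ab by auto
    ultimately have "?g t = ?g a"
      using connected_finite_iff_sing[OF con] by (metis empty_iff singletonD)
    also have "\<dots> = e" using arc(3) z s e by (simp add: sgn_div_norm norm_mult scaleR_conv_of_real)
    finally have "?g t = e" .
    then show ?thesis using Fnz[of t] t False by (auto simp: N_def sgn_eq)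
  qed (use arc F_0 in \<open>auto simp: N_def\<close>)
  define \<mu> where "\<mu> = inv_into {a..b} N"
  have \<mu>: "\<mu> (N t) = t" if "t \<in> {a..b}" for t
    unfolding \<mu>_def using injN that by simp
  have cont\<mu>: "continuous_on (N ` {a..b}) \<mu>"
    by (rule continuous_on_inv[OF contN compact_Icc]) (use \<mu> in blast)
  have "connected (N ` {a..b})" by (intro connected_continuous_image contN connected_Icc)
  moreover have "0 \<in> N ` {a..b}" "s \<in> N ` {a..b}" using Na Nb ab by force+
  ultimately have range: "{0..s} \<subseteq> N ` {a..b}"
    using connected_contains_Icc by blast
  have \<mu>_in: "\<mu> x \<in> {a..b} \<and> N (\<mu> x) = x" if "x \<in> {0..s}" for x
  proof -
    have "x \<in> N ` {a..b}" using that range by blast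
    then show ?thesis unfolding \<mu>_def by (meson f_inv_into_f inv_into_into)
  qed
  show ?thesis
  proof (rule that[of "\<lambda>x. \<gamma> (\<mu> x)"])
    show "continuous_on {0..s} (\<lambda>x. \<gamma> (\<mu> x))"
      by (rule continuous_on_compose2[OF cont\<gamma> continuous_on_subset[OF cont\<mu> range]]) (use \<mu>_in in blast)
    show "(\<lambda>x. \<gamma> (\<mu> x)) ` {0..s} \<subseteq> Z" using \<mu>_in arc(2) by blast
    show "\<gamma> (\<mu> s) = z" using \<mu>[of a] Na arc(3) ab by auto
    show "F (\<gamma> (\<mu> x)) = of_real x * e" if "x \<in> {0..s}" for x
      using dir[of "\<mu> x"] \<mu>_in[OF that] by auto
  qed
qed

text \<open>Uniqueness of lifts: the two lifts of the segment both start at 0, the only zero of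
  \<open>F\<close>, and as \<open>F\<close> is locally injective on \<open>Z\<close>, the parameters
  where they agree form an open and closed set.\<close>

lemma ray_unique:
  assumes e: "cmod e = 1" "Re (e ^ m) = 0" and z: "z \<in> ball 0 r" "F z = of_real s * e"
    and z': "z' \<in> ball 0 r" "F z' = of_real s * e" and s: "s > 0"
  shows "z' = z"
proof -
  obtain \<alpha> where \<alpha>: "continuous_on {0..s} \<alpha>" "\<alpha> ` {0..s} \<subseteq> Z" "\<alpha> s = z"
      "\<And>x. x \<in> {0..s} \<Longrightarrow> F (\<alpha> x) = of_real x * e"
  proof (rule ray_lift[OF e z s])
  qed (rule that)
  obtain \<beta> where \<beta>: "continuous_on {0..s} \<beta>" "\<beta> ` {0..s} \<subseteq> Z" "\<beta> s = z'"
      "\<And>x. x \<in> {0..s} \<Longrightarrow> F (\<beta> x) = of_real x * e"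
  proof (rule ray_lift[OF e z' s])
  qed (rule that)
  define A where "A = {x \<in> {0..s}. \<alpha> x - \<beta> x = 0}"
  have "closedin (top_of_set {0..s}) A"
    unfolding A_def by (intro continuous_closedin_preimage_constant continuous_intros \<alpha> \<beta>)
  moreover have "openin (top_of_set {0..s}) A"
  proof (subst openin_euclidean_subtopology_iff, intro conjI ballI)
    show "A \<subseteq> {0..s}" by (auto simp: A_def)
    fix x assume "x \<in> A"
    then have x: "x \<in> {0..s}" "\<alpha> x = \<beta> x" by (auto simp: A_def)
    have xZ: "\<alpha> x \<in> Z" using x \<alpha>(2) by blast
    obtain d where d: "d > 0" "ball (\<alpha> x) d \<subseteq> ball 0 r" "inj_on F (ball (\<alpha> x) d)"
      by (rule has_complex_derivative_locally_injective[OF holF _ open_ball deriv_F_nonzero[OF xZ]])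
         (use xZ Z_ball in blast)
    obtain d1 where d1: "d1 > 0" "\<And>y. y \<in> {0..s} \<Longrightarrow> dist y x < d1 \<Longrightarrow> dist (\<alpha> y) (\<alpha> x) < d"
      using \<alpha>(1) x d(1) unfolding continuous_on_iff by metis
    obtain d2 where d2: "d2 > 0" "\<And>y. y \<in> {0..s} \<Longrightarrow> dist y x < d2 \<Longrightarrow> dist (\<beta> y) (\<beta> x) < d"
      using \<beta>(1) x d(1) unfolding continuous_on_iff by metis
    show "\<exists>\<epsilon>>0. \<forall>y\<in>{0..s}. dist y x < \<epsilon> \<longrightarrow> y \<in> A"
    proof (intro exI[of _ "min d1 d2"] conjI ballI impI)
      fix y assume y: "y \<in> {0..s}" "dist y x < min d1 d2"
      then have "\<alpha> y \<in> ball (\<alpha> x) d" "\<beta> y \<in> ball (\<alpha> x) d"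
        using d1(2)[of y] d2(2)[of y] x(2) by (auto simp: dist_commute)
      moreover have "F (\<alpha> y) = F (\<beta> y)" using \<alpha>(4) \<beta>(4) y by simp
      ultimately have "\<alpha> y = \<beta> y" using d(3) by (auto dest: inj_onD)
      then show "y \<in> A" using y by (simp add: A_def)
    qed (use d1 d2 in auto)
  qed
  moreover have "0 \<in> A"
  proof -
    have "0 \<in> {0..s}" using s by simp
    then have "F (\<alpha> 0) = 0" "F (\<beta> 0) = 0" "\<alpha> 0 \<in> ball 0 r" "\<beta> 0 \<in> ball 0 r"
      using \<alpha>(2,4) \<beta>(2,4) Z_ball by force+
    then have "\<alpha> 0 = 0" "\<beta> 0 = 0" using F_nonzero by blast+
    then show ?thesis using s by (simp add: A_def)
  qed
  ultimately have "A = {0..s}"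
    using connected_clopen[of "{0..s}"] connected_Icc by blast
  then have "s \<in> A" using s by simp
  then show ?thesis using \<alpha>(3) \<beta>(3) by (simp add: A_def)
qed

text \<open>Otherwise the points over the ray in the closed disk would all avoid the bounding
  circle. One of them maximises the modulus of \<open>F\<close>, and by openness of \<open>F\<close>
  a nearby larger value on the ray would be taken in the disk as well.\<close>

lemma ray_reach:
  assumes e: "cmod e = 1" "Re (e ^ m) = 0" and \<rho>: "0 < \<rho>" "\<rho> < r"
  shows "\<exists>z s. cmod z = \<rho> \<and> s > 0 \<and> F z = of_real s * e"
proof (rule ccontr)
  assume none: "\<not> ?thesis"
  define P where "P = {z \<in> cball 0 \<rho>. \<exists>s\<ge>0. F z = of_real s * e}"
  have enz: "e \<noteq> 0" using e by auto
  have P_eq: "P = {z \<in> cball 0 \<rho>. F z / e - of_real (cmod (F z)) = 0}"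
  proof -
    have "(\<exists>s\<ge>0. F z = of_real s * e) \<longleftrightarrow> F z / e - of_real (cmod (F z)) = 0" for z
    proof
      assume "\<exists>s\<ge>0. F z = of_real s * e"
      then show "F z / e - of_real (cmod (F z)) = 0" using e enz by (auto simp: norm_mult)
    next
      assume "F z / e - of_real (cmod (F z)) = 0"
      then show "\<exists>s\<ge>0. F z = of_real s * e"
        using enz by (intro exI[of _ "cmod (F z)"]) (auto simp: field_simps)
    qed
    then show ?thesis by (simp add: P_def)
  qed
  have sub: "cball 0 \<rho> \<subseteq> ball (0::complex) r" using \<rho> by auto
  have contF: "continuous_on (cball 0 \<rho>) F"
    by (rule holomorphic_on_imp_continuous_on[OF holomorphic_on_subset[OF holF sub]])
  have "closed P"
    unfolding P_eq by (intro continuous_closed_preimage_constant continuous_intros contF closed_cball)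
       (use enz in auto)
  moreover have "bounded P" by (rule bounded_subset[OF bounded_cball[of 0 \<rho>]]) (auto simp: P_def)
  ultimately have "compact P" by (simp add: compact_eq_bounded_closed)
  moreover have "0 \<in> P" using \<rho> F_0 by (auto simp: P_def intro: exI[of _ 0])
  moreover have "continuous_on P (\<lambda>z. cmod (F z))"
    by (intro continuous_on_norm continuous_on_subset[OF contF]) (auto simp: P_def)
  ultimately obtain p where p: "p \<in> P" "\<And>z. z \<in> P \<Longrightarrow> cmod (F z) \<le> cmod (F p)"
    using continuous_attains_sup[of P "\<lambda>z. cmod (F z)"] by blast
  obtain s where s: "s \<ge> 0" "F p = of_real s * e" "cmod p \<le> \<rho>" using p(1) by (auto simp: P_def)
  have "cmod p \<noteq> \<rho>"
  proof
    assume eq: "cmod p = \<rho>"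
    then have "F p \<noteq> 0" using F_nonzero[of p] \<rho> by auto
    then have "s > 0" using s by (cases "s = 0") auto
    then show False using none eq s by blast
  qed
  then have pball: "p \<in> ball 0 \<rho>" using s by simp
  have "\<not> F constant_on ball 0 r"
  proof
    assume "F constant_on ball 0 r"
    then have "f constant_on ball 0 r" unfolding constant_on_def using f_eq by metis
    then show False using nonconst by blast
  qed
  then have "open (F ` ball 0 \<rho>)"
    by (intro open_mapping_thm[OF holF]) (use \<rho> in auto)
  then obtain \<epsilon> where \<epsilon>: "\<epsilon> > 0" "ball (F p) \<epsilon> \<subseteq> F ` ball 0 \<rho>"
    using pball by (meson imageI openE)
  have "of_real (s + \<epsilon> / 2) * e \<in> ball (F p) \<epsilon>"
    using \<epsilon>(1) e by (simp add: s(2) dist_norm distrib_right norm_mult norm_divide)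
  then obtain q where q: "q \<in> ball 0 \<rho>" "F q = of_real (s + \<epsilon> / 2) * e"
    using \<epsilon>(2) by (metis imageE subsetD)
  have "0 \<le> s + \<epsilon> / 2" using s \<epsilon> by simp
  then have "q \<in> P" using q unfolding P_def by auto
  from p(2)[OF this] show False
    using q(2) s \<epsilon> e by (simp add: norm_mult flip: of_real_add of_real_divide)
qed

text \<open>The lift \<open>\<alpha>\<close> of one ray runs from 0 to the outermost of the three
  circles, and the intermediate value theorem finds its crossings with the other two. As the modulus
  of \<open>F\<close> at \<open>\<alpha> x\<close> is \<open>x\<close>, the choice of the crossings
  with \<open>s1 \<le> s2 \<le> s3\<close> gives the comparisons that
  \<open>three_circles_bound\<close> asks for.\<close>

lemma F_bound:
  assumes "w \<in> cball 0 (r * exp (-21))"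
  shows "cmod (F w) \<le> schottky_const\<^sup>2 * r * cmod (deriv F 0)"
proof -
  \<comment> \<open>An \<open>m\<close>-th root of \<open>\<i>\<close>, hence a direction with
    \<open>Re (e ^ m) = 0\<close>.\<close>
  define e where "e = cis (pi / (2 * real m))"
  have "real m * (pi / (2 * real m)) = pi / 2" using m_pos by simp
  then have "e ^ m = cis (pi / 2)" by (simp only: e_def Complex.DeMoivre)
  then have e: "cmod e = 1" "Re (e ^ m) = 0" by (auto simp: e_def)
  obtain z3 s3 where z3: "cmod z3 = r * exp (-7)" "s3 > 0" "F z3 = of_real s3 * e"
    using ray_reach[OF e, of "r * exp (-7)"] r_pos by auto
  have z3ball: "z3 \<in> ball 0 r" using z3 r_pos by simp
  obtain \<alpha> where \<alpha>: "continuous_on {0..s3} \<alpha>" "\<alpha> ` {0..s3} \<subseteq> Z" "\<alpha> s3 = z3"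
      "\<And>x. x \<in> {0..s3} \<Longrightarrow> F (\<alpha> x) = of_real x * e"
  proof (rule ray_lift[OF e z3ball z3(3,2)])
  qed (rule that)
  have \<alpha>ball: "\<alpha> x \<in> ball 0 r" if "x \<in> {0..s3}" for x using that \<alpha>(2) Z_ball by blast
  have \<alpha>0: "\<alpha> 0 = 0" using F_nonzero[OF \<alpha>ball[of 0]] \<alpha>(4)[of 0] z3 by simp
  have contn: "continuous_on {0..x} (\<lambda>x. cmod (\<alpha> x))" if "x \<le> s3" for x
    using that by (intro continuous_on_norm continuous_on_subset[OF \<alpha>(1)]) auto
  have "\<exists>x\<ge>0. x \<le> s3 \<and> cmod (\<alpha> x) = r * exp (-14)"
    by (rule IVT'[OF _ _ _ contn]) (use \<alpha> \<alpha>0 z3 r_pos in auto)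
  then obtain s2 where s2: "0 \<le> s2" "s2 \<le> s3" "cmod (\<alpha> s2) = r * exp (-14)" by blast
  have "\<exists>x\<ge>0. x \<le> s2 \<and> cmod (\<alpha> x) = r * exp (-21)"
    by (rule IVT'[OF _ _ _ contn]) (use \<alpha>0 s2 r_pos in auto)
  then obtain s1 where s1: "0 \<le> s1" "s1 \<le> s2" "cmod (\<alpha> s1) = r * exp (-21)" by blast
  have "s2 > 0" using s2 \<alpha>0 r_pos by (cases "s2 = 0") auto
  have F\<alpha>: "cmod (F (\<alpha> x)) = x" if "x \<in> {0..s3}" for x
    using \<alpha>(4)[OF that] that e by (simp add: norm_mult)
  show ?thesis
  proof (rule three_circles_bound[OF r_pos holF F_0 F_nonzero dF_0, of "\<alpha> s1" "\<alpha> s2" z3])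
    show "z = \<alpha> s2" if "z \<in> ball 0 r" "F z = F (\<alpha> s2)" for z
      by (rule ray_unique[OF e, of _ s2]) (use that \<alpha>(4)[of s2] \<alpha>ball[of s2] s2 \<open>s2 > 0\<close> in auto)
    show "cmod (F (\<alpha> s1)) \<le> cmod (F (\<alpha> s2))" "cmod (F (\<alpha> s2)) \<le> cmod (F z3)"
      using F\<alpha>[of s1] F\<alpha>[of s2] F\<alpha>[of s3] \<alpha>(3) s1 s2 z3 by auto
  qed (use s1 s2 z3 assms in auto)
qed

end

section \<open>Curvature of nodal curves in terms of \<open>F\<close>\<close>

lemma deriv_real_line_Im_zero:
  assumes hol: "H holomorphic_on S" "open S" and t: "of_real t \<in> S"
    and real: "\<And>s :: real. of_real s \<in> S \<Longrightarrow> Im (H (of_real s)) = 0"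
  shows "Im (deriv H (of_real t)) = 0"
proof -
  have "(H has_field_derivative deriv H (of_real t)) (at (of_real t))"
    by (rule holomorphic_derivI[OF hol t])
  then have "((\<lambda>s. H (of_real s)) has_vector_derivative deriv H (of_real t)) (at t)"
    by (rule has_vector_derivative_real_field)
  from bounded_linear.has_vector_derivative[OF bounded_linear_Im this]
  have 1: "((\<lambda>s. Im (H (of_real s))) has_vector_derivative Im (deriv H (of_real t))) (at t)" .
  have "open ((of_real :: real \<Rightarrow> complex) -` S)"
    by (intro open_vimage hol continuous_intros)
  then have "((\<lambda>s. Im (H (of_real s))) has_vector_derivative 0) (at t)"
    by (rule has_vector_derivative_transform_within_open[OF has_vector_derivative_const])
       (use t real in auto)
  then show ?thesis using 1 vector_derivative_unique_at by blast
qed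

context nodal_root
begin

text \<open>\<open>F\<close> maps the nodal curve into a line through 0, so with \<open>p = F \<circ> \<gamma>\<close> both \<open>p' / p\<close> and
  \<open>p'' / p\<close> are real, hence so is \<open>p'' / p' = (F'' \<circ> \<gamma>) \<gamma>' / (F' \<circ> \<gamma>) + \<gamma>'' / \<gamma>'\<close>.\<close>

lemma curvature_bound:
  assumes \<gamma>: "regular_analytic_param \<gamma> I" "\<gamma> ` I \<subseteq> Z" and t: "t \<in> I" "\<gamma> t \<noteq> 0"
  shows "\<bar>curvature \<gamma> t\<bar> \<le> cmod (deriv (deriv F) (\<gamma> t) / deriv F (\<gamma> t))"
proof -
  obtain G d where G: "d > 0" "ball t d \<subseteq> I" "G holomorphic_on ball (of_real t) d"
    "\<And>s. s \<in> ball t d \<Longrightarrow> \<gamma> s = G (of_real s)"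
    "\<And>s. s \<in> ball t d \<Longrightarrow> (\<gamma> has_vector_derivative deriv G (of_real s)) (at s)"
    "\<And>s. s \<in> ball t d \<Longrightarrow> deriv G (of_real s) \<noteq> 0"
  proof (rule regular_analytic_param_extend[OF \<gamma>(1) t(1)])
  qed (rule that)
  define T where "T = complex_of_real t"
  have real_ball: "complex_of_real s \<in> ball T d \<longleftrightarrow> s \<in> ball t d" for s
    by (simp add: T_def dist_norm flip: of_real_diff)
  \<comment> \<open>Complex parameters at which \<open>\<Phi>\<close> is defined and nonzero, so
    that its logarithmic derivative \<open>q\<close> is holomorphic.\<close>
  define S where "S = ball T d \<inter> G -` (ball 0 r - {0})"
  have holG: "G holomorphic_on ball T d" using G(3) by (simp add: T_def)
  have S: "open S" "S \<subseteq> ball T d" unfolding S_def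
    by (intro continuous_open_preimage holomorphic_on_imp_continuous_on holG) (auto intro: open_Diff)
  have GT: "G T = \<gamma> t" using G(1,4) by (simp add: T_def)
  have tZ: "\<gamma> t \<in> Z" using \<gamma>(2) t by blast
  then have TS: "T \<in> S" using GT t(2) G(1) Z_ball by (auto simp: S_def)
  define \<Phi> where "\<Phi> = (\<lambda>w. F (G w))"
  have GS: "G w \<in> ball 0 r" "G w \<noteq> 0" if "w \<in> S" for w using that by (auto simp: S_def)
  have holGS: "G holomorphic_on S" using holG S(2) holomorphic_on_subset by blast
  have hol\<Phi>: "\<Phi> holomorphic_on S"
    unfolding \<Phi>_def
    by (rule holomorphic_on_compose_gen[OF holGS holF, unfolded o_def]) (use GS in blast)
  have \<Phi>nz: "\<Phi> w \<noteq> 0" if "w \<in> S" for w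
    using F_nonzero GS[OF that] by (auto simp: \<Phi>_def)
  have \<Phi>_der: "(\<Phi> has_field_derivative deriv F (G w) * deriv G w) (at w)" if "w \<in> S" for w
  proof -
    have "(F has_field_derivative deriv F (G w)) (at (G w))" "(G has_field_derivative deriv G w) (at w)"
      using holomorphic_derivI[OF holF open_ball] GS[OF that] holomorphic_derivI[OF holGS S(1) that] by auto
    from DERIV_chain[OF this] show ?thesis by (simp add: \<Phi>_def o_def)
  qed
  have d\<Phi>: "deriv \<Phi> w = deriv F (G w) * deriv G w" if "w \<in> S" for w
    using \<Phi>_der[OF that] by (rule DERIV_imp_deriv)
  define q where "q = (\<lambda>w. deriv \<Phi> w / \<Phi> w)"
  have hold\<Phi>: "deriv \<Phi> holomorphic_on S" by (rule holomorphic_deriv[OF hol\<Phi> S(1)])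
  have holq: "q holomorphic_on S"
    unfolding q_def by (intro holomorphic_intros hol\<Phi> hold\<Phi> \<Phi>nz)
  have q_real: "Im (q (of_real s)) = 0" if s: "of_real s \<in> S" for s :: real
  proof -
    \<comment> \<open>As \<open>f\<close> is imaginary on \<open>Z\<close>, \<open>H\<close> is real
      at real parameters, whichever ray the curve lies over. Its logarithmic derivative is
      \<open>m\<close> times \<open>q\<close>, so \<open>q\<close> is real there and the ray need
      not be identified.\<close>
    define H where "H = (\<lambda>w. \<i> * \<Phi> w ^ m)"
    have holH: "H holomorphic_on S" unfolding H_def by (intro holomorphic_intros hol\<Phi>)
    have H_real: "Im (H (of_real s)) = 0" if "of_real s \<in> S" for s :: real
    proof -
      have "s \<in> ball t d" using that S(2) real_ball by blast
      then have "\<gamma> s \<in> Z" "\<gamma> s = G (of_real s)" using \<gamma>(2) G(2,4) by blast+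
      then have "Re (f (G (of_real s))) = 0" by (simp add: Z_def)
      then show ?thesis using f_eq[OF GS(1)[OF that]] by (simp add: H_def \<Phi>_def)
    qed
    have dH: "deriv H (of_real s) = of_nat m * q (of_real s) * H (of_real s)"
    proof (rule DERIV_imp_deriv)
      have "(H has_field_derivative \<i> * (of_nat m * (deriv \<Phi> (of_real s) * \<Phi> (of_real s) ^ (m - 1)))) (at (of_real s))"
        unfolding H_def using holomorphic_derivI[OF hol\<Phi> S(1) s]
        by (auto intro!: derivative_eq_intros)
      moreover have "\<Phi> (of_real s) ^ m = \<Phi> (of_real s) * \<Phi> (of_real s) ^ (m - 1)"
        using m_pos by (cases m) auto
      ultimately show "(H has_field_derivative of_nat m * q (of_real s) * H (of_real s)) (at (of_real s))"
        using \<Phi>nz[OF s] by (simp add: H_def q_def mult_ac)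
    qed
    have "Im (deriv H (of_real s)) = 0"
      by (rule deriv_real_line_Im_zero[OF holH S(1) s H_real])
    moreover have "H (of_real s) \<noteq> 0" using \<Phi>nz[OF s] by (simp add: H_def)
    then have "Re (H (of_real s)) \<noteq> 0" using H_real[OF s] by (auto simp: complex_eq_iff)
    ultimately show ?thesis using dH H_real[OF s] m_pos by simp
  qed
  have q'_real: "Im (deriv q T) = 0"
    using deriv_real_line_Im_zero[OF holq S(1) TS[unfolded T_def] q_real] by (simp add: T_def)
  have dq: "deriv q T = deriv (deriv \<Phi>) T / \<Phi> T - q T * q T"
  proof (rule DERIV_imp_deriv)
    show "(q has_field_derivative deriv (deriv \<Phi>) T / \<Phi> T - q T * q T) (at T)"
      unfolding q_def using \<Phi>nz[OF TS] holomorphic_derivI[OF hol\<Phi> S(1) TS] holomorphic_derivI[OF hold\<Phi> S(1) TS]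
      by (auto intro!: derivative_eq_intros simp: field_simps)
  qed
  define A B where "A = deriv G T" and "B = deriv (deriv G) T"
  have Anz: "A \<noteq> 0" using G(1,6) by (simp add: A_def T_def)
  have F'nz: "deriv F (\<gamma> t) \<noteq> 0" by (rule deriv_F_nonzero[OF tZ])
  have qnz: "q T \<noteq> 0" using d\<Phi>[OF TS] \<Phi>nz[OF TS] Anz F'nz by (simp add: q_def A_def GT)
  have ImqT: "Im (q T) = 0" using q_real[of t] TS by (simp add: T_def)
  have "deriv (deriv \<Phi>) T = deriv (deriv F) (\<gamma> t) * A\<^sup>2 + deriv F (\<gamma> t) * B"
  proof (rule DERIV_imp_deriv)
    have gb: "\<gamma> t \<in> ball 0 r" using tZ Z_ball by blast
    have dG: "(G has_field_derivative A) (at T)" "(deriv G has_field_derivative B) (at T)"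
      unfolding A_def B_def using G(1)
      by (auto intro!: holomorphic_derivI[OF holG] holomorphic_derivI[OF holomorphic_deriv[OF holG]])
    have "(deriv F has_field_derivative deriv (deriv F) (\<gamma> t)) (at (G T))"
      unfolding GT by (rule holomorphic_derivI[OF holomorphic_deriv[OF holF open_ball] open_ball gb])
    from DERIV_chain[OF this dG(1)]
    have "((\<lambda>w. deriv F (G w)) has_field_derivative deriv (deriv F) (\<gamma> t) * A) (at T)"
      by (simp add: o_def)
    from DERIV_mult[OF this dG(2)]
    have "((\<lambda>w. deriv F (G w) * deriv G w) has_field_derivative
        deriv (deriv F) (\<gamma> t) * A\<^sup>2 + deriv F (\<gamma> t) * B) (at T)"
      by (simp add: GT A_def[symmetric] power2_eq_square mult_ac)
    then show "(deriv \<Phi> has_field_derivative deriv (deriv F) (\<gamma> t) * A\<^sup>2 + deriv F (\<gamma> t) * B) (at T)"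
      by (rule has_field_derivative_transform_within_open[OF _ S(1) TS]) (simp add: d\<Phi>)
  qed
  moreover have "deriv \<Phi> T = deriv F (\<gamma> t) * A" using d\<Phi>[OF TS] by (simp add: GT A_def)
  ultimately have "deriv (deriv \<Phi>) T / deriv \<Phi> T = deriv (deriv F) (\<gamma> t) / deriv F (\<gamma> t) * A + B / A"
    using Anz F'nz by (simp add: field_simps power2_eq_square)
  \<comment> \<open>From \<open>\<Phi>' = q * \<Phi>\<close> it follows that
    \<open>\<Phi>'' = (q' + q * q) * \<Phi>\<close>; the quotient is real because \<open>q\<close>
    and \<open>q'\<close> are real at \<open>T\<close>.\<close>
  moreover have "deriv (deriv \<Phi>) T / deriv \<Phi> T = (deriv q T + q T * q T) / q T"
    using dq \<Phi>nz[OF TS] qnz by (auto simp: q_def field_simps)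
  moreover have "Im ((deriv q T + q T * q T) / q T) = 0"
    using q'_real ImqT by (simp add: Im_divide)
  ultimately have ImB: "Im (B / A) = - Im (deriv (deriv F) (\<gamma> t) / deriv F (\<gamma> t) * A)"
    by simp
  have v: "vector_derivative \<gamma> (at s) = deriv G (of_real s)" if "s \<in> ball t d" for s
    using G(5)[OF that] by (rule vector_derivative_at)
  have "((\<lambda>s. deriv G (of_real s)) has_vector_derivative B) (at t)"
    unfolding B_def T_def using G(1)
    by (intro has_vector_derivative_real_field holomorphic_derivI[OF holomorphic_deriv[OF G(3) open_ball] open_ball]) auto
  then have "((\<lambda>s. vector_derivative \<gamma> (at s)) has_vector_derivative B) (at t)"
    by (rule has_vector_derivative_transform_within_open[of _ _ _ "ball t d"]) (use G(1) v in auto)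
  then have w: "vector_derivative (\<lambda>s. vector_derivative \<gamma> (at s)) (at t) = B"
    by (rule vector_derivative_at)
  have vt: "vector_derivative \<gamma> (at t) = A" using v[of t] G(1) by (simp add: A_def T_def)
  have Im_of_real_mult: "Im (of_real x * z) = x * Im z" for x z by simp
  \<comment> \<open>This turns the curvature into \<open>Im (B / A) / cmod A\<close>. The factor
    \<open>A\<close> in \<open>ImB\<close> then cancels against \<open>cmod A\<close>, leaving a
    bound independent of the parametrisation.\<close>
  have "cnj A * B = of_real ((cmod A)\<^sup>2) * (B / A)"
    unfolding complex_norm_square using Anz by simp
  then have "Im (cnj A * B) = (cmod A)\<^sup>2 * Im (B / A)" by (simp only: Im_of_real_mult)
  then have "\<bar>curvature \<gamma> t\<bar> = \<bar>Im (B / A)\<bar> / cmod A"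
    using Anz by (simp add: curvature_def vt w Let_def abs_mult power2_eq_square power3_eq_cube)
  also have "\<dots> \<le> cmod (deriv (deriv F) (\<gamma> t) / deriv F (\<gamma> t) * A) / cmod A"
    unfolding ImB using abs_Im_le_cmod by (intro divide_right_mono) auto
  also have "\<dots> = cmod (deriv (deriv F) (\<gamma> t) / deriv F (\<gamma> t))"
    using Anz by (simp add: norm_mult norm_divide)
  finally show ?thesis .
qed

text \<open>For the disk of radius \<open>r * exp (- 21)\<close> and the bound
  \<open>schottky_const\<^sup>2 * r\<close> of \<open>F_bound\<close>, the constant of
  \<open>deriv2_over_deriv_bound\<close> becomes \<open>K / r\<close>; this is where the scaling in
  \<open>r\<close> appears.\<close>

lemma nodal_curvature_le:
  assumes K: "K = 8 * schottky_const\<^sup>2 / (exp (- 21))\<^sup>2"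
    and \<gamma>: "regular_analytic_param \<gamma> I" "\<gamma> ` I \<subseteq> Z" and t: "t \<in> I" "\<gamma> t \<noteq> 0"
    and small: "cmod (\<gamma> t) \<le> r * (exp (- 21) / 2)" "cmod (\<gamma> t) \<le> r / (2 * K)"
  shows "\<bar>curvature \<gamma> t\<bar> \<le> 2 * K / r"
proof -
  define q where "q = exp (- 21 :: real)"
  have q: "0 < q" "q < 1" by (auto simp: q_def)
  have Kpos: "K > 0" using K by (simp add: schottky_const_def)
  have "\<bar>curvature \<gamma> t\<bar> \<le> cmod (deriv (deriv F) (\<gamma> t) / deriv F (\<gamma> t))"
    by (rule curvature_bound[OF \<gamma> t])
  also have "\<dots> \<le> 2 * (K / r)"
  proof (rule deriv2_over_deriv_bound(2)[OF _ holF _ _ _ _ dF_0, of "r * q"])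
    show "cmod (F z) \<le> schottky_const\<^sup>2 * r * cmod (deriv F 0)" if "z \<in> cball 0 (r * q)" for z
      using F_bound that by (simp add: q_def)
    show "K / r = 8 * (schottky_const\<^sup>2 * r) / (r * q)\<^sup>2"
      using r_pos q by (simp add: K q_def[symmetric] field_simps power2_eq_square)
  qed (use r_pos q Kpos small in \<open>auto simp: q_def[symmetric] field_simps\<close>)
  finally show ?thesis by simp
qed

end

theorem theorem4:
  fixes n :: nat
  assumes "n \<ge> 1"
  shows "\<exists>c C :: real. 0 < c \<and> c < 1 \<and> C > 0 \<and>
    (\<forall>(r\<^sub>0 :: real) (u :: complex \<Rightarrow> real).
       r\<^sub>0 > 0 \<longrightarrow>
       u harmonic_on ball 0 r\<^sub>0 \<longrightarrow>
       \<not> u constant_on ball 0 r\<^sub>0 \<longrightarrow>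
       has_L1_boundary_value u r\<^sub>0 \<longrightarrow>
       u 0 = 0 \<longrightarrow>
       only_nodal_curves_through_0 u r\<^sub>0 n \<longrightarrow>
       (\<forall>z \<in> (nodal_set u r\<^sub>0 - {0}) \<inter> ball 0 (c * r\<^sub>0).
          \<forall>k. has_nodal_curvature u r\<^sub>0 z k \<longrightarrow> \<bar>k\<bar> \<le> C / r\<^sub>0))"
proof -
  define K where "K = 8 * schottky_const\<^sup>2 / (exp (- 21 :: real))\<^sup>2"
  \<comment> \<open>The first entry leaves room for Cauchy's inequality at half the radius of the
    disk of \<open>F_bound\<close>, the second keeps \<open>F'\<close> at least half as large as at
    0.\<close>
  define c where "c = min (exp (- 21) / 2) (1 / (2 * K))"
  have Kpos: "K > 0" by (simp add: K_def schottky_const_def)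
  have "exp (- 21 :: real) < 1" by simp
  then have "exp (- 21 :: real) / 2 < 1" by linarith
  then have c: "0 < c" "c < 1" using Kpos by (auto simp: c_def)
  have "\<bar>k\<bar> \<le> 2 * K / r"
    if r: "r > 0" and u: "u harmonic_on ball 0 r" "\<not> u constant_on ball 0 r" "u 0 = 0"
      and only: "only_nodal_curves_through_0 u r n"
      and z: "z \<in> (nodal_set u r - {0}) \<inter> ball 0 (c * r)" and k: "has_nodal_curvature u r z k"
    for r u z k
  proof -
    obtain f where f: "f holomorphic_on ball 0 r" "\<And>z. z \<in> ball 0 r \<Longrightarrow> Re (f z) = u z" "f 0 = 0"
    proof (rule harmonic_on_ball_imp_Re[OF u(1) r u(3)])
    qed (rule that)
    interpret holomorphic_nodal f r
    proof
      show "\<not> f constant_on ball 0 r"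
      proof
        assume "f constant_on ball 0 r"
        then have "u constant_on ball 0 r" unfolding constant_on_def using f(2) by metis
        then show False using u(2) by blast
      qed
    qed fact+
    have Z_eq: "nodal_set u r = Z" unfolding nodal_set_def Z_def using f(2) by auto
    have curve: "\<gamma> ` I \<subseteq> Z" if "C \<in> nodal_curves u r" "\<gamma> ` I = C" for C \<gamma> I
    proof -
      have "C \<subseteq> nodal_set u r"
        using that(1) unfolding nodal_curves_def analytic_curves_in_def by blast
      then show ?thesis using that(2) Z_eq by simp
    qed
    interpret star_shaped_nodal f r
    proof
      fix w assume "w \<in> Z"
      then obtain C where C: "C \<in> nodal_curves u r" "w \<in> C" "0 \<in> C"
        using only by (auto simp: only_nodal_curves_through_0_def Z_eq)
      then obtain \<gamma> I where "regular_analytic_param \<gamma> I" "C = \<gamma> ` I"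
        by (auto simp: nodal_curves_def analytic_curves_in_def)
      then show "\<exists>\<gamma> I. regular_analytic_param \<gamma> I \<and> \<gamma> ` I \<subseteq> Z \<and> w \<in> \<gamma> ` I \<and> 0 \<in> \<gamma> ` I"
        using C curve by blast
    qed
    obtain m F where mF: "m > 0" "F holomorphic_on ball 0 r"
        "\<And>z. z \<in> ball 0 r \<Longrightarrow> f z = F z ^ m" "F 0 = 0" "deriv F 0 \<noteq> 0"
    proof (rule root_exists)
    qed (rule that)
    interpret nodal_root f r F m
      by unfold_locales fact+
    obtain \<gamma> I t where \<gamma>: "regular_analytic_param \<gamma> I" "\<gamma> ` I \<subseteq> Z" "t \<in> I" "\<gamma> t = z" "k = curvature \<gamma> t"
      using k curve unfolding has_nodal_curvature_def by metis
    have "\<bar>curvature \<gamma> t\<bar> \<le> 2 * K / r"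
    proof (rule nodal_curvature_le[OF K_def \<gamma>(1-3)])
      have "cmod z < c * r" using z by simp
      also have "c * r \<le> r * (exp (- 21) / 2)"
        using r by (simp add: c_def mult.commute)
      finally show "cmod (\<gamma> t) \<le> r * (exp (- 21) / 2)" using \<gamma>(4) by simp
      have "cmod z < c * r" using z by simp
      also have "c * r \<le> 1 / (2 * K) * r"
        using r by (intro mult_right_mono) (auto simp: c_def)
      finally show "cmod (\<gamma> t) \<le> r / (2 * K)" using \<gamma>(4) by simp
    qed (use z \<gamma>(4) in auto)
    then show ?thesis using \<gamma>(5) by simp
  qed
  then show ?thesis
    using c Kpos by (intro exI[of _ c] exI[of _ "2 * K"]) auto
qed

end
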